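(* Let $\Gamma$ be a finite graph with at least $3$ vertices. (i) If $\Gamma$ is the $1$-skeleton of some finite simplicial flag complex $L$ which is a homology $n$-manifold for some $n\ge 1$, then $\Gamma$ is reconstructible. (ii) In particular, if $\Gamma$ is the $1$-skeleton of some flag triangulation $L$ of some $n$-manifold ($n\ge 1$), then $\Gamma$ is reconstructible.
   Context: Graphs are finite simple undirected graphs. For a graph $\Gamma$ with vertex set $S$ and $T\subseteq S$, $\Gamma_T$ denotes the full (induced) subgraph of $\Gamma$ with vertex set $T$. A graph $\Gamma$ with vertex set $S$ is called reconstructible if every graph $\Gamma'$ (with vertex set $S'$) for which there exists a bijection $f:S\to S'$ such that $\Gamma_{S-\{s\}}$ and $\Gamma'_{S'-\{f(s)\}}$ are isomorphic for every $s\in S$, is isomorphic to $\Gamma$. A simplicial complex $L$ is a flag complex if whenever a finite set of vertices $\{s_0,\dots,s_k\}$ is pairwise joined by edges of $L$, it spans a $k$-simplex of $L$. A finite simplicial complex $L$ is a homology $n$-manifold if for every point $x\in|L|$, $H_i(|L|,|L|-\{x\})\cong H_i(\mathbb{S}^n)$ for all $i$ (integer homology). A flag triangulation of a space is a triangulation by a simplicial complex that is a flag complex. *)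

theory Defs
  imports "HOL-Analysis.Analysis" "HOL-Homology.Homology" "Graph_Theory.Graph_Theory"
begin

text \<open>
  A finite simple undirected graph is a \<open>pair_graph\<close>, i.e. a finite vertex set together with an
  irreflexive symmetric adjacency relation on it; \<open>with_proj\<close> views it as a general digraph,
  on which \<open>\<restriction>\<close> (full subgraph) and \<open>digraph_iso\<close> are available.
\<close>

text \<open>
  The graphs \<open>\<Gamma>'\<close> range over a type \<open>'b\<close> of vertices that is independent of the one
  of \<open>\<Gamma>\<close>.  A statement that leaves \<open>'b\<close> a type variable covers all graphs \<open>\<Gamma>'\<close>.
\<close>

definition reconstructible :: "'b itself \<Rightarrow> 'a pair_pre_digraph \<Rightarrow> bool" where
  "reconstructible TYPE('b) \<Gamma> \<longleftrightarrow>
     (\<forall>\<Gamma>' :: 'b pair_pre_digraph.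
        pair_graph \<Gamma>' \<and>
        (\<exists>f. bij_betw f (pverts \<Gamma>) (pverts \<Gamma>') \<and>
             (\<forall>s \<in> pverts \<Gamma>.
                digraph_iso (with_proj \<Gamma> \<restriction> (pverts \<Gamma> - {s}))
                            (with_proj \<Gamma>' \<restriction> (pverts \<Gamma>' - {f s})))) \<longrightarrow>
        digraph_iso (with_proj \<Gamma>') (with_proj \<Gamma>))"

text \<open>
  Abstract simplicial complexes, given by their sets of (nonempty) simplices.  The complexes of
  \<^theory>\<open>HOL-Analysis.Polytope\<close> are instead sets of convex hulls of points of a Euclidean space.
\<close>

definition abstract_simplicial_complex :: "'a set set \<Rightarrow> bool" where
  "abstract_simplicial_complex L \<longleftrightarrow>
     (\<forall>\<sigma> \<in> L. finite \<sigma> \<and> \<sigma> \<noteq> {}) \<and>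
     (\<forall>\<sigma> \<in> L. \<forall>\<tau>. \<tau> \<subseteq> \<sigma> \<and> \<tau> \<noteq> {} \<longrightarrow> \<tau> \<in> L)"

definition flag_complex :: "'a set set \<Rightarrow> bool" where
  "flag_complex L \<longleftrightarrow>
     abstract_simplicial_complex L \<and>
     (\<forall>T. finite T \<and> T \<noteq> {} \<and> T \<subseteq> \<Union>L \<and>
          (\<forall>u \<in> T. \<forall>v \<in> T. u \<noteq> v \<longrightarrow> {u, v} \<in> L) \<longrightarrow> T \<in> L)"

definition one_skeleton :: "'a set set \<Rightarrow> 'a pair_pre_digraph" where
  "one_skeleton L = \<lparr> pverts = \<Union>L, parcs = {(u, v). u \<noteq> v \<and> {u, v} \<in> L} \<rparr>"

text \<open>
  The points of \<open>|L|\<close> are given by their barycentric coordinates.  For finite \<open>L\<close>, the only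
  complexes to which this is applied, the product topology used here is the usual (weak)
  topology of \<open>|L|\<close>.
\<close>

definition geometric_realization :: "'a set set \<Rightarrow> ('a \<Rightarrow> real) topology" where
  "geometric_realization L =
     subtopology (powertop_real UNIV)
       {x. \<exists>\<sigma> \<in> L. (\<forall>v. 0 \<le> x v) \<and> (\<forall>v. v \<notin> \<sigma> \<longrightarrow> x v = 0) \<and> (\<Sum>v\<in>\<sigma>. x v) = 1}"

text \<open>
  Local homology is compared with the \<^emph>\<open>reduced\<close> homology of the sphere: unreduced homology has
  a nonzero \<open>H\<^sub>0\<close>, while for \<open>n \<ge> 1\<close> the local \<open>H\<^sub>0\<close> of an \<open>n\<close>-manifold vanishes.
\<close>

definition homology_manifold :: "nat \<Rightarrow> 'a set set \<Rightarrow> bool" where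
  "homology_manifold n L \<longleftrightarrow>
     (let X = geometric_realization L in
      \<forall>x \<in> topspace X. \<forall>i :: int.
        relative_homology_group i X (topspace X - {x}) \<cong>
        reduced_homology_group i (nsphere n))"

definition topological_manifold :: "nat \<Rightarrow> 'a topology \<Rightarrow> bool" where
  "topological_manifold n X \<longleftrightarrow>
     Hausdorff_space X \<and> second_countable X \<and>
     (\<forall>x \<in> topspace X. \<exists>U V. openin X U \<and> x \<in> U \<and> openin (Euclidean_space n) V \<and>
        subtopology X U homeomorphic_space subtopology (Euclidean_space n) V)"

definition flag_triangulation_of :: "'a set set \<Rightarrow> 'c topology \<Rightarrow> bool" where
  "flag_triangulation_of L M \<longleftrightarrow>
     flag_complex L \<and> geometric_realization L homeomorphic_space M"

end

theory Submission
  imports Defs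
begin

text \<open>
  Local homology at interior points of simplices shows that in a homology \<open>n\<close>-manifold every maximal
  simplex has \<open>n + 1\<close> vertices and every \<open>(n - 1)\<close>-simplex lies in exactly two \<open>n\<close>-simplices: with one
  \<open>n\<close>-simplex the local homology vanishes, and with three or more it is not cyclic.  For a flag complex
  this is a condition on the cliques of the graph.

  Counting pairs of a deleted vertex and an \<open>n\<close>-clique avoiding it, the deck determines
  \<open>\<Sum>C. (m C - 2)\<^sup>2\<close>, where \<open>m C\<close> is the number of \<open>(n + 1)\<close>-cliques containing the \<open>n\<close>-clique \<open>C\<close>.  Hence
  \<open>m = 2\<close> also in every reconstruction.  In the graph with \<open>s\<close> deleted, the vertices of \<open>n\<close>-cliques with
  \<open>m \<noteq> 2\<close> are then precisely the former neighbours of \<open>s\<close>; in the reconstruction they are at least among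
  the neighbours, and are all of them because degrees are determined by the deck.
\<close>

section \<open>Reconstruction from a clique condition\<close>

definition cliques :: "'a rel \<Rightarrow> nat \<Rightarrow> 'a set \<Rightarrow> 'a set set" where
  "cliques E k V = {C. C \<subseteq> V \<and> card C = k \<and> (\<forall>u\<in>C. \<forall>v\<in>C. u \<noteq> v \<longrightarrow> (u, v) \<in> E)}"

definition common_nbrs :: "'a rel \<Rightarrow> 'a set \<Rightarrow> 'a set \<Rightarrow> 'a set" where
  "common_nbrs E V C = {x \<in> V. \<forall>u\<in>C. (u, x) \<in> E}"

text \<open>Edges are compared inside \<open>V\<close> only, so a vertex-deleted subgraph is given
  by \<open>V - {s}\<close> with \<open>E\<close> left unchanged.\<close>

definition rel_iso :: "('a \<Rightarrow> 'b) \<Rightarrow> 'a set \<Rightarrow> 'a rel \<Rightarrow> 'b set \<Rightarrow> 'b rel \<Rightarrow> bool" where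
  "rel_iso g V E V' E' \<longleftrightarrow> bij_betw g V V' \<and> (\<forall>u\<in>V. \<forall>v\<in>V. (u, v) \<in> E \<longleftrightarrow> (g u, g v) \<in> E')"

lemma finite_cliques [simp]: "finite V \<Longrightarrow> finite (cliques E k V)"
  by (rule finite_subset[of _ "Pow V"]) (auto simp: cliques_def)

lemma cliques_subset: "C \<in> cliques E k V \<Longrightarrow> C \<subseteq> V"
  by (simp add: cliques_def)

lemma common_nbrs_subset: "common_nbrs E V C \<subseteq> V"
  by (auto simp: common_nbrs_def)

lemma common_nbrs_disjoint: "irrefl E \<Longrightarrow> common_nbrs E V C \<inter> C = {}"
  by (auto simp: common_nbrs_def irrefl_def)

lemma cliques_delete: "cliques E k (V - {t}) = {C \<in> cliques E k V. t \<notin> C}"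
  by (auto simp: cliques_def)

lemma common_nbrs_delete: "common_nbrs E (V - {t}) C = common_nbrs E V C - {t}"
  by (auto simp: common_nbrs_def)

lemma rel_iso_cliques:
  assumes g: "rel_iso g V E V' E'"
  shows "bij_betw ((`) g) (cliques E k V) (cliques E' k V')"
proof (rule bij_betw_imageI)
  have b: "bij_betw g V V'" and e: "\<And>u v. u \<in> V \<Longrightarrow> v \<in> V \<Longrightarrow> (u, v) \<in> E \<longleftrightarrow> (g u, g v) \<in> E'"
    using g by (auto simp: rel_iso_def)
  note inj = bij_betw_imp_inj_on[OF b]
  show "inj_on ((`) g) (cliques E k V)"
    by (rule inj_on_subset[OF inj_on_image_Pow[OF inj]]) (auto dest: cliques_subset)
  have sub: "g ` C \<in> cliques E' k V'" if "C \<in> cliques E k V" for C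
  proof -
    have C: "C \<subseteq> V" "card C = k" and cl: "\<And>u v. u\<in>C \<Longrightarrow> v\<in>C \<Longrightarrow> u \<noteq> v \<Longrightarrow> (u, v) \<in> E"
      using that by (auto simp: cliques_def)
    have "card (g ` C) = k" using C inj by (metis card_image inj_on_subset)
    moreover have "g ` C \<subseteq> V'" using C b by (auto simp: bij_betw_def)
    ultimately show ?thesis using cl C e by (auto simp: cliques_def) (metis subsetD)
  qed
  have "D \<in> (`) g ` cliques E k V" if D: "D \<in> cliques E' k V'" for D
  proof -
    have "D \<subseteq> g ` V" using D b by (auto simp: cliques_def bij_betw_def)
    then obtain C where C: "C \<subseteq> V" "D = g ` C" by (auto simp: subset_image_iff)
    have "C \<in> cliques E k V"
      using D C e inj by (auto simp: cliques_def card_image inj_on_subset inj_on_eq_iff subset_iff)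
    then show ?thesis using C by blast
  qed
  then show "(`) g ` cliques E k V = cliques E' k V'" using sub by blast
qed

lemma rel_iso_common_nbrs:
  assumes g: "rel_iso g V E V' E'" and C: "C \<subseteq> V"
  shows "common_nbrs E' V' (g ` C) = g ` common_nbrs E V C"
proof -
  have V': "V' = g ` V" using g by (auto simp: rel_iso_def bij_betw_def)
  have "\<And>u v. u \<in> V \<Longrightarrow> v \<in> V \<Longrightarrow> (u, v) \<in> E \<longleftrightarrow> (g u, g v) \<in> E'" using g by (simp add: rel_iso_def)
  then show ?thesis unfolding V' using C by (auto simp: common_nbrs_def subset_iff image_iff)
qed

lemma card_rel_iso_common_nbrs:
  assumes g: "rel_iso g V E V' E'" and C: "C \<subseteq> V"
  shows "card (common_nbrs E' V' (g ` C)) = card (common_nbrs E V C)"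
  unfolding rel_iso_common_nbrs[OF g C]
  by (rule card_image, rule inj_on_subset[OF _ common_nbrs_subset])
    (use g in \<open>auto simp: rel_iso_def bij_betw_def\<close>)

text \<open>Applied to each card, this makes every sum of a function of the number of common
  neighbours a quantity read off from the deck.\<close>

lemma sum_cliques_rel_iso:
  fixes h :: "nat \<Rightarrow> real"
  assumes g: "rel_iso g V E V' E'"
  shows "(\<Sum>C\<in>cliques E' k V'. h (card (common_nbrs E' V' C))) =
         (\<Sum>C\<in>cliques E k V. h (card (common_nbrs E V C)))"
  unfolding sum.reindex_bij_betw[OF rel_iso_cliques[OF g], symmetric]
  by (intro sum.cong refl) (simp add: card_rel_iso_common_nbrs[OF g] cliques_subset)

text \<open>Kelly's double counting of pairs of a deleted vertex and a clique avoiding it.\<close>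

lemma sum_cliques_vertex_deleted:
  fixes h :: "nat \<Rightarrow> real"
  assumes V: "finite V" and E: "irrefl E"
  shows "(\<Sum>t\<in>V. \<Sum>C\<in>cliques E k (V - {t}). h (card (common_nbrs E (V - {t}) C))) =
         (\<Sum>C\<in>cliques E k V. let m = card (common_nbrs E V C) in
            real m * h (m - 1) + (real (card V) - real k - real m) * h m)"
proof -
  have "(\<Sum>t\<in>V. \<Sum>C\<in>cliques E k (V - {t}). h (card (common_nbrs E (V - {t}) C))) =
        (\<Sum>t\<in>V. \<Sum>C\<in>{C \<in> cliques E k V. t \<notin> C}. h (card (common_nbrs E V C - {t})))"
    by (simp add: cliques_delete common_nbrs_delete)
  \<comment> \<open>Exchanging the sums counts each clique once for every vertex outside it.\<close>
  also have "\<dots> = (\<Sum>C\<in>cliques E k V. \<Sum>t\<in>{t \<in> V. t \<notin> C}. h (card (common_nbrs E V C - {t})))"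
    using V by (intro sum.swap_restrict) auto
  also have "\<dots> = (\<Sum>C\<in>cliques E k V. let m = card (common_nbrs E V C) in
            real m * h (m - 1) + (real (card V) - real k - real m) * h m)"
  proof (rule sum.cong[OF refl])
    fix C assume "C \<in> cliques E k V"
    then have C: "C \<subseteq> V" "card C = k" by (auto simp: cliques_def)
    define M where "M = common_nbrs E V C"
    have M: "M \<subseteq> V - C" using common_nbrs_disjoint[OF E, of V C] common_nbrs_subset[of E V C]
      by (auto simp: M_def)
    have fin: "finite (V - C)" "finite M" "finite C"
      using V M C by (auto intro: finite_subset)
    \<comment> \<open>Deleting a vertex outside \<open>C\<close> lowers the number of common
      neighbours by one if the vertex lies in \<open>M\<close>, and leaves it unchanged
      otherwise.\<close>
    have "{t \<in> V. t \<notin> C} = V - C" by auto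
    then have "(\<Sum>t\<in>{t \<in> V. t \<notin> C}. h (card (M - {t}))) = (\<Sum>t\<in>M. h (card (M - {t}))) + (\<Sum>t\<in>V - C - M. h (card (M - {t})))"
      using fin M by (simp add: sum.subset_diff add.commute)
    also have "\<dots> = (\<Sum>t\<in>M. h (card M - 1)) + (\<Sum>t\<in>V - C - M. h (card M))"
      by (intro arg_cong2[of _ _ _ _ "(+)"] sum.cong) (auto simp: fin)
    also have "\<dots> = real (card M) * h (card M - 1) + real (card (V - C - M)) * h (card M)" by simp
    also have "card (V - C - M) = card V - card C - card M" using fin M C V
      by (simp add: card_Diff_subset)
    also have "real \<dots> = real (card V) - real k - real (card M)"
    proof -
      have "card M \<le> card (V - C)" using fin M by (simp add: card_mono)
      also have "\<dots> = card V - card C" using fin C by (simp add: card_Diff_subset)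
      finally show ?thesis using C V card_mono[OF V C(1)] by simp
    qed
    finally show "(\<Sum>t\<in>{t \<in> V. t \<notin> C}. h (card (common_nbrs E V C - {t}))) = (let m = card (common_nbrs E V C) in
            real m * h (m - 1) + (real (card V) - real k - real m) * h m)"
      by (simp add: M_def Let_def)
  qed
  finally show ?thesis .
qed

text \<open>The 1-cliques are the vertices, so both sums are degree sums. Deleting \<open>t\<close>
  loses the degree of \<open>t\<close> itself and one from the degree of each of its
  neighbours.\<close>

lemma sum_degrees_delete:
  assumes V: "finite V" and E: "irrefl E" "sym E" and t: "t \<in> V"
  shows "(\<Sum>C\<in>cliques E 1 V. real (card (common_nbrs E V C))) =
         (\<Sum>C\<in>cliques E 1 (V - {t}). real (card (common_nbrs E (V - {t}) C))) +
         2 * real (card (common_nbrs E V {t}))"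
proof -
  have singletons: "(\<Sum>C\<in>cliques E 1 W. w C) = (\<Sum>v\<in>W. w {v})" for W and w :: "'a set \<Rightarrow> real"
  proof -
    have "cliques E 1 W = (\<lambda>v. {v}) ` W"
      by (force simp: cliques_def card_1_singleton_iff)
    then show ?thesis by (simp add: sum.reindex)
  qed
  define N where "N = (\<lambda>v. common_nbrs E V {v})"
  have fN: "finite (N v)" for v unfolding N_def using V by (rule finite_subset[OF common_nbrs_subset])
  have Nt: "N t \<subseteq> V - {t}" using E by (auto simp: N_def common_nbrs_def irrefl_def)
  have "(\<Sum>v\<in>V - {t}. real (card (N v))) = (\<Sum>v\<in>V - {t}. real (card (N v - {t})) + (if v \<in> N t then 1 else 0))"
  proof (rule sum.cong[OF refl])
    fix v assume v: "v \<in> V - {t}"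
    have tv: "t \<in> N v \<longleftrightarrow> v \<in> N t"
      using E(2) t v by (auto simp: N_def common_nbrs_def dest: symD)
    show "real (card (N v)) = real (card (N v - {t})) + (if v \<in> N t then 1 else 0)"
    proof (cases "t \<in> N v")
      case True
      then show ?thesis using card.remove[OF fN True] tv by simp
    next
      case False
      then have "N v - {t} = N v" by blast
      then show ?thesis using False tv by simp
    qed
  qed
  also have "\<dots> = (\<Sum>v\<in>V - {t}. real (card (N v - {t}))) + real (card (N t))"
    using V Nt by (simp add: sum.distrib sum.If_cases Int_absorb1 Int_absorb2)
  finally show ?thesis unfolding singletons common_nbrs_delete N_def[symmetric]
    using V t by (simp add: sum.remove[OF V t] N_def)
qed

section \<open>Two graphs with the same deck\<close>

locale same_deck =
  fixes V :: "'a set" and E :: "'a rel" and V' :: "'b set" and E' :: "'b rel" and f :: "'a \<Rightarrow> 'b"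
  assumes finite_V: "finite V" and irrefl_E: "irrefl E" and irrefl_E': "irrefl E'"
    and sym_E: "sym E" and sym_E': "sym E'"
    and bij_f: "bij_betw f V V'"
    and cards: "s \<in> V \<Longrightarrow> \<exists>g. rel_iso g (V - {s}) E (V' - {f s}) E'"
begin

lemma finite_V': "finite V'"
  using bij_f finite_V bij_betw_finite by blast

lemma card_V': "card V' = card V"
  using bij_f bij_betw_same_card by metis

text \<open>Both double counts run over the cards, which \<open>f\<close> matches up to isomorphism;
  the weights \<open>w\<close> agree because \<open>V\<close> and \<open>V'\<close> have equal
  size.\<close>

lemma kelly:
  fixes h :: "nat \<Rightarrow> real" and k :: nat
  defines "w \<equiv> \<lambda>m. real m * h (m - 1) + (real (card V) - real k - real m) * h m"
  shows "(\<Sum>C\<in>cliques E' k V'. w (card (common_nbrs E' V' C))) =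
         (\<Sum>C\<in>cliques E k V. w (card (common_nbrs E V C)))"
proof -
  have "(\<Sum>C\<in>cliques E' k V'. w (card (common_nbrs E' V' C))) =
        (\<Sum>t\<in>V'. \<Sum>C\<in>cliques E' k (V' - {t}). h (card (common_nbrs E' (V' - {t}) C)))"
    unfolding sum_cliques_vertex_deleted[OF finite_V' irrefl_E'] w_def Let_def card_V' ..
  also have "\<dots> = (\<Sum>s\<in>V. \<Sum>C\<in>cliques E' k (V' - {f s}). h (card (common_nbrs E' (V' - {f s}) C)))"
    by (rule sum.reindex_bij_betw[OF bij_f, symmetric])
  also have "\<dots> = (\<Sum>s\<in>V. \<Sum>C\<in>cliques E k (V - {s}). h (card (common_nbrs E (V - {s}) C)))"
    by (intro sum.cong refl) (use cards sum_cliques_rel_iso in blast)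
  also have "\<dots> = (\<Sum>C\<in>cliques E k V. w (card (common_nbrs E V C)))"
    unfolding sum_cliques_vertex_deleted[OF finite_V irrefl_E] w_def Let_def ..
  finally show ?thesis .
qed

text \<open>A sum of squares determined by the deck vanishes for the first graph, hence for the
  second, and then so does each of its terms.\<close>

lemma two_nbrs_transfer:
  assumes two: "\<And>C. C \<in> cliques E k V \<Longrightarrow> card (common_nbrs E V C) = 2"
    and big: "card V \<ge> k + 3" and C: "C \<in> cliques E' k V'"
  shows "card (common_nbrs E' V' C) = 2"
proof -
  define q where "q = real (card V) - real k"
  \<comment> \<open>This keeps the denominators \<open>q\<close>, \<open>q - 1\<close> and
    \<open>q - 2\<close> away from zero.\<close>
  have q: "q \<ge> 3" using big by (simp add: q_def)
  text \<open>Chosen so that the weight of a clique with \<open>m\<close> common neighbours in \<open>kelly\<close> is \<open>(m - 2)\<^sup>2\<close>.\<close>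
  define h where "h = (\<lambda>m::nat. real m * (real m - 1) / (q - 2) - 3 * real m / (q - 1) + 4 / q)"
  have w: "real m * h (m - 1) + (real (card V) - real k - real m) * h m = (real m - 2)\<^sup>2" for m
  \<comment> \<open>Subtraction in \<open>m - 1\<close> is truncated, so \<open>m = 0\<close> is
    treated apart: the factor \<open>m\<close> removes the first term and
    \<open>q * (4 / q) = (0 - 2)\<^sup>2\<close> remains.\<close>
  proof (cases m)
    case 0
    then show ?thesis using q by (simp add: h_def q_def[symmetric])
  next
    case (Suc j)
    have *: "real m * h (m - 1) + (real (card V) - real k - real m) * h m =
      real m * (real j * (real j - 1) / (q - 2) - 3 * real j / (q - 1) + 4 / q) + (q - real m) *
        (real m * (real m - 1) / (q - 2) - 3 * real m / (q - 1) + 4 / q)"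
      by (simp add: Suc h_def q_def)
    \<comment> \<open>Grouped by denominator, the brackets collapse to \<open>q - 2\<close>,
      \<open>q - 1\<close> and \<open>q\<close> and cancel.\<close>
    also have "\<dots> = real m * (real m - 1) * ((real m - 2) + (q - real m)) / (q - 2)
       - 3 * real m * ((real m - 1) + (q - real m)) / (q - 1) + 4 * (real m + (q - real m)) / q"
      by (simp add: Suc diff_divide_distrib add_divide_distrib algebra_simps)
    also have "\<dots> = real m * (real m - 1) - 3 * real m + 4" using q by simp
    finally show ?thesis by (simp add: power2_eq_square algebra_simps)
  qed
  have "(\<Sum>C\<in>cliques E' k V'. (real (card (common_nbrs E' V' C)) - 2)\<^sup>2) = 0"
    unfolding kelly[where h = h and k = k, unfolded w] using two by simp
  then have "(real (card (common_nbrs E' V' C)) - 2)\<^sup>2 = 0"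
    using C finite_V' by (subst (asm) sum_nonneg_eq_0_iff) auto
  then show ?thesis by simp
qed


text \<open>The total degree is determined by the deck, and the total degree of the card of
  \<open>s\<close> falls short of it by twice the degree of \<open>s\<close>.\<close>

lemma degree_eq:
  assumes "card V \<ge> 3" and s: "s \<in> V"
  shows "card (common_nbrs E' V' {f s}) = card (common_nbrs E V {s})"
proof -
  define q where "q = real (card V) - 1"
  have q: "q > 1" using assms by (simp add: q_def)
  \<comment> \<open>For 1-cliques and the identity as \<open>h\<close>, the weight in
    \<open>kelly\<close> is proportional to the degree.\<close>
  have w: "real m * real (m - 1) + (q - real m) * real m = (q - 1) * real m" for m
    by (cases m) (auto simp: algebra_simps)
  have "(q - 1) * (\<Sum>C\<in>cliques E' 1 V'. real (card (common_nbrs E' V' C))) =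
        (q - 1) * (\<Sum>C\<in>cliques E 1 V. real (card (common_nbrs E V C)))"
    using kelly[where h = real and k = 1] unfolding of_nat_1 q_def[symmetric] w sum_distrib_left .
  then have tot: "(\<Sum>C\<in>cliques E' 1 V'. real (card (common_nbrs E' V' C))) =
      (\<Sum>C\<in>cliques E 1 V. real (card (common_nbrs E V C)))" using q by simp
  obtain g where g: "rel_iso g (V - {s}) E (V' - {f s}) E'" using cards[OF s] by blast
  have fs: "f s \<in> V'" using bij_f s by (auto simp: bij_betw_def)
  show ?thesis
    using sum_degrees_delete[OF finite_V irrefl_E sym_E s] tot
      sum_degrees_delete[OF finite_V' irrefl_E' sym_E' fs] sum_cliques_rel_iso[OF g, of real 1]
    by simp
qed

end

section \<open>Recovering the neighbours of a deleted vertex\<close>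

definition defective :: "'a rel \<Rightarrow> nat \<Rightarrow> 'a set \<Rightarrow> 'a set" where
  "defective E k V = \<Union>{C \<in> cliques E k V. card (common_nbrs E V C) \<noteq> 2}"

text \<open>An isomorphism of cards thus respects these sets without any reference to the deleted
  vertices.\<close>

lemma rel_iso_defective:
  assumes g: "rel_iso g V E V' E'"
  shows "defective E' k V' = g ` defective E k V"
proof -
  have "cliques E' k V' = (`) g ` cliques E k V"
    using rel_iso_cliques[OF g] by (simp add: bij_betw_def)
  then have "{C \<in> cliques E' k V'. card (common_nbrs E' V' C) \<noteq> 2} =
     (`) g ` {C \<in> cliques E k V. card (common_nbrs E V C) \<noteq> 2}"
    using card_rel_iso_common_nbrs[OF g] cliques_subset[of _ E k V] by auto
  then show ?thesis unfolding defective_def by (auto simp: image_Union)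
qed

text \<open>Deleting \<open>s\<close> changes the count of a clique only if \<open>s\<close> is one
  of its common neighbours, and then every vertex of the clique is adjacent to
  \<open>s\<close>.\<close>

lemma defective_delete_subset:
  assumes "\<And>C. C \<in> cliques E k V \<Longrightarrow> card (common_nbrs E V C) = 2" and "sym E"
  shows "defective E k (V - {s}) \<subseteq> common_nbrs E V {s}"
proof
  fix v assume "v \<in> defective E k (V - {s})"
  then obtain C where C: "C \<in> cliques E k (V - {s})" "card (common_nbrs E V C - {s}) \<noteq> 2" "v \<in> C"
    by (auto simp: defective_def common_nbrs_delete)
  have "s \<in> common_nbrs E V C" using C assms(1)[of C] by (cases "s \<in> common_nbrs E V C") (auto simp: cliques_delete)
  then show "v \<in> common_nbrs E V {s}" using C assms(2) by (auto simp: common_nbrs_def cliques_def dest: symD)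
qed

text \<open>A neighbour of \<open>s\<close> lies with \<open>s\<close> in some
  \<open>(k + 1)\<close>-clique \<open>D\<close>; the clique \<open>D - {s}\<close> loses the common
  neighbour \<open>s\<close> and drops below two.\<close>

lemma defective_delete_superset:
  assumes two: "\<And>C. C \<in> cliques E k V \<Longrightarrow> card (common_nbrs E V C) = 2" and s: "s \<in> V"
    and pure: "\<And>v. v \<in> V \<Longrightarrow> (s, v) \<in> E \<Longrightarrow> \<exists>D\<in>cliques E (Suc k) V. s \<in> D \<and> v \<in> D" and E: "irrefl E"
  shows "common_nbrs E V {s} \<subseteq> defective E k (V - {s})"
proof
  fix v assume "v \<in> common_nbrs E V {s}"
  then have v: "v \<in> V" "(s, v) \<in> E" by (auto simp: common_nbrs_def)
  then have "v \<noteq> s" using E by (auto simp: irrefl_def)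
  obtain D where D: "D \<in> cliques E (Suc k) V" "s \<in> D" "v \<in> D" using pure[OF v] by blast
  then have C: "D - {s} \<in> cliques E k V" by (auto simp: cliques_def)
  have "s \<in> common_nbrs E V (D - {s})" using D s by (auto simp: cliques_def common_nbrs_def)
  moreover have "card (common_nbrs E V (D - {s})) = 2" by (rule two[OF C])
  ultimately have "card (common_nbrs E V (D - {s}) - {s}) \<noteq> 2" by simp
  moreover have "D - {s} \<in> cliques E k (V - {s})" using C by (simp add: cliques_delete)
  ultimately show "v \<in> defective E k (V - {s})"
    using D \<open>v \<noteq> s\<close> unfolding defective_def common_nbrs_delete by blast
qed

lemma clique_insert:
  assumes "D \<in> cliques E k V" "x \<in> common_nbrs E V D" "irrefl E" "sym E" "finite V"
  shows "insert x D \<in> cliques E (Suc k) V"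
proof -
  have "x \<notin> D" using assms common_nbrs_disjoint by blast
  moreover have "finite D" using assms by (auto simp: cliques_def intro: finite_subset)
  ultimately show ?thesis using assms by (auto simp: cliques_def common_nbrs_def dest: symD)
qed

text \<open>A facet \<open>D\<close> and the facets across two of its ridges already have \<open>k + 3\<close> vertices between them.\<close>

lemma card_ge_of_two_nbrs:
  assumes two: "\<And>C. C \<in> cliques E k V \<Longrightarrow> card (common_nbrs E V C) = 2" and k: "k \<ge> 1"
    and D: "D \<in> cliques E (Suc k) V" and none: "cliques E (Suc (Suc k)) V = {}"
    and E: "irrefl E" "sym E" and V: "finite V"
  shows "card V \<ge> k + 3"
proof -
  have cD: "card D = Suc k" and DV: "D \<subseteq> V" using D by (auto simp: cliques_def)
  have fD: "finite D" using DV V by (rule finite_subset)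
  have facet: "D - {c} \<in> cliques E k V" "c \<in> common_nbrs E V (D - {c})" if "c \<in> D" for c
    using that D by (auto simp: cliques_def common_nbrs_def)
  \<comment> \<open>\<open>y\<close> is the apex of the facet on the other side of the ridge
    \<open>D - {c}\<close>.\<close>
  have other: "\<exists>y. common_nbrs E V (D - {c}) = {c, y} \<and> y \<notin> D \<and> y \<in> V" if c: "c \<in> D" for c
  proof -
    obtain a b where ab: "common_nbrs E V (D - {c}) = {a, b}" "a \<noteq> b"
      using two[OF facet(1)[OF c]] by (auto simp: card_2_iff)
    then obtain y where y: "common_nbrs E V (D - {c}) = {c, y}" "y \<noteq> c"
      using facet(2)[OF c] by fastforce
    then show ?thesis using common_nbrs_disjoint[OF E(1), of V "D - {c}"] common_nbrs_subset[of E V "D - {c}"] by blast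
  qed
  obtain a b where ab: "a \<in> D" "b \<in> D" "a \<noteq> b"
    using cD k by (metis One_nat_def card_le_Suc0_iff_eq fD not_less_eq_eq)
  obtain y where y: "common_nbrs E V (D - {a}) = {a, y}" "y \<notin> D" "y \<in> V" using other[OF ab(1)] by blast
  obtain z where z: "common_nbrs E V (D - {b}) = {b, z}" "z \<notin> D" "z \<in> V" using other[OF ab(2)] by blast
  \<comment> \<open>Each vertex of \<open>D\<close> lies in \<open>D - {a}\<close> or in
    \<open>D - {b}\<close>, so a shared apex would extend \<open>D\<close> to a clique of size
    \<open>k + 2\<close>.\<close>
  have "y \<noteq> z"
  proof
    assume "y = z"
    then have "y \<in> common_nbrs E V (D - {a})" "y \<in> common_nbrs E V (D - {b})" using y z by auto
    then have "y \<in> common_nbrs E V D" using ab by (auto simp: common_nbrs_def)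
    then have "insert y D \<in> cliques E (Suc (Suc k)) V" using D E V by (intro clique_insert)
    then show False using none by simp
  qed
  then have "card (insert y (insert z D)) = k + 3" using y z fD cD by simp
  then show ?thesis using y z DV V by (metis card_mono insert_subset)
qed

text \<open>The isomorphism of a single card is extended by sending \<open>s\<close> to
  \<open>f s\<close>. The rest of the deck enters through \<open>two_nbrs_transfer\<close> and
  \<open>degree_eq\<close>.\<close>

theorem (in same_deck) reconstruction:
  assumes two: "\<And>C. C \<in> cliques E k V \<Longrightarrow> card (common_nbrs E V C) = 2" and k: "k \<ge> 1"
    and vertex: "\<And>v. v \<in> V \<Longrightarrow> \<exists>D\<in>cliques E (Suc k) V. v \<in> D"
    and edge: "\<And>u v. u \<in> V \<Longrightarrow> v \<in> V \<Longrightarrow> (u, v) \<in> E \<Longrightarrow> \<exists>D\<in>cliques E (Suc k) V. u \<in> D \<and> v \<in> D"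
    and none: "cliques E (Suc (Suc k)) V = {}" and "V \<noteq> {}"
  shows "\<exists>g. rel_iso g V E V' E'"
proof -
  obtain s where s: "s \<in> V" using \<open>V \<noteq> {}\<close> by blast
  obtain D where "D \<in> cliques E (Suc k) V" using vertex[OF s] by blast
  then have big: "card V \<ge> k + 3"
    using two k none irrefl_E sym_E finite_V by (intro card_ge_of_two_nbrs)
  obtain g where g: "rel_iso g (V - {s}) E (V' - {f s}) E'" using cards[OF s] by blast
  have gb: "bij_betw g (V - {s}) (V' - {f s})"
    and ge: "\<And>u v. u \<in> V - {s} \<Longrightarrow> v \<in> V - {s} \<Longrightarrow> (u, v) \<in> E \<longleftrightarrow> (g u, g v) \<in> E'"
    using g by (auto simp: rel_iso_def)
  have fs: "f s \<in> V'" using bij_f s by (auto simp: bij_betw_def)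
  define N where "N = common_nbrs E V {s}"
  define N' where "N' = common_nbrs E' V' {f s}"
  have N: "N \<subseteq> V - {s}" using common_nbrs_disjoint[OF irrefl_E] common_nbrs_subset by (fastforce simp: N_def)
  have bad: "defective E k (V - {s}) = N"
    unfolding N_def using two s edge irrefl_E sym_E
    by (intro equalityI defective_delete_subset defective_delete_superset) auto
  have "g ` N = defective E' k (V' - {f s})"
    using rel_iso_defective[OF g] bad by metis
  \<comment> \<open>Only this inclusion is available at first: the second graph is not known to have
    each of its edges in a \<open>(k + 1)\<close>-clique.\<close>
  also have "\<dots> \<subseteq> N'" unfolding N'_def
    using two_nbrs_transfer[OF two big] sym_E' by (intro defective_delete_subset) auto
  finally have sub: "g ` N \<subseteq> N'" .
  \<comment> \<open>Equal degrees turn the inclusion into an equality.\<close>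
  have "card N' = card N" unfolding N_def N'_def using degree_eq[OF _ s] big by simp
  also have "\<dots> = card (g ` N)" using gb N by (metis bij_betw_def card_image inj_on_subset)
  finally have eq: "g ` N = N'" using sub finite_V'
    by (metis N'_def card_subset_eq common_nbrs_subset finite_subset)
  define G where "G = (\<lambda>v. if v = s then f s else g v)"
  have "bij_betw G V V'"
  proof -
    have "bij_betw G (V - {s}) (V' - {f s})"
      using gb by (subst bij_betw_cong[of _ G g]) (auto simp: G_def)
    then have "bij_betw G ((V - {s}) \<union> {s}) ((V' - {f s}) \<union> {f s})"
      by (rule bij_betw_combine) (auto simp: G_def)
    moreover have "(V - {s}) \<union> {s} = V" "(V' - {f s}) \<union> {f s} = V'" using s fs by auto
    ultimately show ?thesis by simp
  qed
  moreover have "(u, v) \<in> E \<longleftrightarrow> (G u, G v) \<in> E'" if uv: "u \<in> V" "v \<in> V" for u v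
  proof -
    have star: "(s, v) \<in> E \<longleftrightarrow> (f s, g v) \<in> E'" if "v \<in> V - {s}" for v
    proof -
      have "(s, v) \<in> E \<longleftrightarrow> v \<in> N" using that by (auto simp: N_def common_nbrs_def)
      also have "\<dots> \<longleftrightarrow> g v \<in> N'" using gb N that unfolding eq[symmetric]
        by (metis bij_betw_imp_inj_on inj_on_image_mem_iff)
      also have "\<dots> \<longleftrightarrow> (f s, g v) \<in> E'"
        using gb that by (auto simp: N'_def common_nbrs_def bij_betw_def)
      finally show ?thesis .
    qed
    consider "u = s" "v = s" | "u = s" "v \<noteq> s" | "u \<noteq> s" "v = s" | "u \<noteq> s" "v \<noteq> s" by blast
    then show ?thesis
    proof cases
      case 1
      then show ?thesis using irrefl_E irrefl_E' by (simp add: irrefl_def)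
    next
      case 2
      then show ?thesis using star uv by (simp add: G_def)
    next
      case 3
      then show ?thesis using star[of u] uv sym_E sym_E' by (auto simp: G_def dest: symD)
    next
      case 4
      then show ?thesis using ge uv by (simp add: G_def)
    qed
  qed
  ultimately show ?thesis unfolding rel_iso_def by blast
qed

section \<open>Local homology\<close>

text \<open>Excision of \<open>topspace X - S\<close>, whose closure misses the open set
  \<open>U\<close> around \<open>x\<close>; the T1 property makes the complement of \<open>x\<close>
  open.\<close>

lemma relative_homology_neighbourhood:
  assumes t1: "t1_space X" and U: "openin X U" "x \<in> U" and S: "U \<subseteq> S" "S \<subseteq> topspace X"
  shows "relative_homology_group p (subtopology X S) (S - {x}) \<cong>
         relative_homology_group p X (topspace X - {x})"
proof -
  have x: "x \<in> topspace X" using U S by blast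
  have "closedin X {x}" using t1 x by (simp add: t1_space_closedin_singleton)
  then have o: "openin X (topspace X - {x})" by blast
  have "closedin X (topspace X - U)" using U by blast
  then have "X closure_of (topspace X - S) \<subseteq> topspace X - U"
    using S by (intro closure_of_minimal) auto
  also have "\<dots> \<subseteq> X interior_of (topspace X - {x})"
    using U by (simp add: interior_of_openin[OF o]) blast
  finally have "hom_induced p (subtopology X (topspace X - (topspace X - S))) (topspace X - {x} - (topspace X - S))
       (subtopology X (topspace X)) (topspace X - {x}) id
    \<in> iso (relative_homology_group p (subtopology X (topspace X - (topspace X - S))) (topspace X - {x} - (topspace X - S)))
          (relative_homology_group p (subtopology X (topspace X)) (topspace X - {x}))"
    by (rule homology_excision_axiom) auto
  moreover have "topspace X - (topspace X - S) = S" "topspace X - {x} - (topspace X - S) = S - {x}"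
    using S by auto
  ultimately show ?thesis by (simp add: is_isoI)
qed

lemma trivial_groups_isomorphic:
  "trivial_group G \<Longrightarrow> trivial_group H \<Longrightarrow> G \<cong> H"
proof -
  assume G: "trivial_group G" and H: "trivial_group H"
  then have "(\<lambda>_. \<one>\<^bsub>H\<^esub>) \<in> iso G H"
    unfolding trivial_group_def iso_def hom_def bij_betw_def
    using group.is_monoid[of H] by (simp add: monoid.l_one)
  then show ?thesis by (rule is_isoI)
qed

text \<open>Complements of homeomorphic closed sets have isomorphic relative homology, so
  \<open>y\<close> may be moved to the origin. Stabilising by \<open>n\<close> dimensions then
  reduces the claim to the homology of a point in degree \<open>p - n\<close>.\<close>

lemma local_homology_Euclidean_space:
  assumes y: "y \<in> topspace (Euclidean_space n)"
  shows "relative_homology_group p (Euclidean_space n) (topspace (Euclidean_space n) - {y}) \<cong>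
         reduced_homology_group p (nsphere n)"
proof -
  define o0 :: "nat \<Rightarrow> real" where "o0 = (\<lambda>i. 0)"
  have t: "topspace (Euclidean_space 0) = {o0}" by (auto simp: topspace_Euclidean_space o0_def)
  have cl: "closedin (Euclidean_space m) {z}" if "z \<in> topspace (Euclidean_space m)" for m z
    by (rule closedin_Hausdorff_singleton[OF Hausdorff_Euclidean_space that])
  have o: "o0 \<in> topspace (Euclidean_space n)" by (simp add: topspace_Euclidean_space o0_def)
  have "relative_homology_group p (Euclidean_space n) (topspace (Euclidean_space n) - {y}) \<cong>
        relative_homology_group p (Euclidean_space n) (topspace (Euclidean_space n) - {o0})"
  proof (rule isomorphic_relative_homology_groups_Euclidean_complements[OF cl[OF y] cl[OF o]])
    have "homeomorphic_maps (subtopology (Euclidean_space n) {y}) (subtopology (Euclidean_space n) {o0}) (\<lambda>_. o0) (\<lambda>_. y)"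
      using y o by (auto simp: homeomorphic_maps_def)
    then show "subtopology (Euclidean_space n) {y} homeomorphic_space subtopology (Euclidean_space n) {o0}"
      unfolding homeomorphic_space_def by blast
  qed
  \<comment> \<open>In dimension 0 the complement of the origin is empty, so the relative group is
    the absolute one.\<close>
  moreover have "homology_group (p - int n) (Euclidean_space 0) \<cong>
      relative_homology_group p (Euclidean_space n) (topspace (Euclidean_space n) - {o0})"
    using relative_homology_group_Euclidean_complement_step[of 0 "{o0}" "p - int n" n] cl[of o0 0]
    by (simp add: t)
  moreover have "homology_group (p - int n) (Euclidean_space 0) \<cong> reduced_homology_group p (nsphere n)"
  proof (cases "p = int n")
    case True
    have "homology_group (p - int n) (Euclidean_space 0) \<cong> integer_group"
      using homology_coefficients[OF t] by (simp add: True)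
    moreover have "integer_group \<cong> reduced_homology_group p (nsphere n)"
      using reduced_homology_group_nsphere(1) True group.iso_sym group_reduced_homology_group by blast
    ultimately show ?thesis by (rule iso_trans)
  next
    case False
    then show ?thesis
      using homology_dimension_axiom[OF t, of "p - int n"] reduced_homology_group_nsphere(2)[OF False]
      by (intro trivial_groups_isomorphic) auto
  qed
  ultimately show ?thesis
    by (meson group.iso_sym iso_trans group_relative_homology_group)
qed

lemma homeomorphic_space_relative_homology:
  assumes "homeomorphic_maps X Y f g" "x \<in> topspace X"
  shows "relative_homology_group p X (topspace X - {x}) \<cong> relative_homology_group p Y (topspace Y - {f x})"
proof -
  have h: "homeomorphic_map X Y f" using assms homeomorphic_map_maps by blast
  have "f ` (topspace X - {x}) = f ` topspace X - f ` {x}"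
    using homeomorphic_imp_injective_map[OF h] assms(2) by (intro inj_on_image_set_diff[of f "topspace X"]) auto
  then have "f ` (topspace X - {x}) = topspace Y - {f x}"
    by (simp add: homeomorphic_imp_surjective_map[OF h])
  then show ?thesis using homeomorphic_map_relative_homology_iso[OF h, of "topspace X - {x}"] is_isoI by blast
qed

text \<open>Excise to the chart domain, transport along the chart, and use excision again to pass
  from \<open>V\<close> to the whole Euclidean space.\<close>

lemma local_homology_chart:
  assumes t1: "t1_space X" and U: "openin X U" "x \<in> U" and V: "openin (Euclidean_space n) V"
    and hom: "subtopology X U homeomorphic_space subtopology (Euclidean_space n) V"
  shows "relative_homology_group p X (topspace X - {x}) \<cong> reduced_homology_group p (nsphere n)"
proof -
  obtain f g where fg: "homeomorphic_maps (subtopology X U) (subtopology (Euclidean_space n) V) f g"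
    using hom unfolding homeomorphic_space_def by blast
  have tU: "topspace (subtopology X U) = U" and tV: "topspace (subtopology (Euclidean_space n) V) = V"
    using openin_subset[OF U(1)] openin_subset[OF V] by (auto simp: topspace_subtopology_subset)
  have fx: "f x \<in> V" using fg U tU tV by (auto simp: homeomorphic_maps_def continuous_map_def)
  have "relative_homology_group p X (topspace X - {x}) \<cong> relative_homology_group p (subtopology X U) (U - {x})"
    using relative_homology_neighbourhood[OF t1 U subset_refl] U
    by (meson group.iso_sym group_relative_homology_group openin_subset)
  also have "\<dots> \<cong> relative_homology_group p (subtopology (Euclidean_space n) V) (V - {f x})"
    using homeomorphic_space_relative_homology[OF fg, of x p] U unfolding tU tV by blast
  also have "\<dots> \<cong> relative_homology_group p (Euclidean_space n) (topspace (Euclidean_space n) - {f x})"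
    using V Hausdorff_Euclidean_space Hausdorff_imp_t1_space fx
    by (intro relative_homology_neighbourhood[of _ V]) (auto simp: openin_subset)
  also have "\<dots> \<cong> reduced_homology_group p (nsphere n)"
    using fx V by (intro local_homology_Euclidean_space) (auto dest: openin_subset)
  finally show ?thesis .
qed

text \<open>The integers are Hopfian: the transported map \<open>c\<close> is multiplication by
  \<open>c 1\<close>, and surjectivity forces \<open>c 1\<close> to be nonzero.\<close>

lemma epi_integer_groups_inj:
  assumes "G \<cong> integer_group" "H \<cong> integer_group" "group G" "group H" and r: "r \<in> hom G H"
    and surj: "carrier H \<subseteq> r ` carrier G"
  shows "inj_on r (carrier G)"
proof -
  obtain a where a: "a \<in> iso integer_group G"
    using group.iso_sym[OF \<open>group G\<close> \<open>G \<cong> integer_group\<close>] unfolding is_iso_def by blast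
  obtain b where b: "b \<in> iso H integer_group"
    using \<open>H \<cong> integer_group\<close> unfolding is_iso_def by blast
  define c where "c = b \<circ> r \<circ> a"
  have ah: "a \<in> hom integer_group G" "bij_betw a UNIV (carrier G)"
    and bh: "b \<in> hom H integer_group" "bij_betw b (carrier H) UNIV"
    using a b by (auto simp: iso_def)
  have "c \<in> hom integer_group integer_group"
    unfolding c_def using ah bh r by (intro hom_compose[OF _ hom_compose]) (auto simp: comp_assoc)
  then have c: "c (x + y) = c x + c y" for x y by (simp add: hom_def)
  have c0: "c 0 = 0" using c[of 0 0] by simp
  have cneg: "c (- x) = - c x" for x using c[of x "- x"] c0 by simp
  have cn: "c (int k) = int k * c 1" for k
    by (induction k) (auto simp: c0 c algebra_simps)
  have cmult: "c k = k * c 1" for k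
  proof (cases "k \<ge> 0")
    case True then show ?thesis using cn[of "nat k"] by simp
  next
    case False then show ?thesis using cn[of "nat (- k)"] cneg[of k] by simp
  qed
  have "\<exists>k. c k = 1"
  proof -
    obtain h where h: "h \<in> carrier H" "b h = 1" using bh(2) by (metis UNIV_I bij_betw_def imageE)
    then obtain g where g: "g \<in> carrier G" "h = r g" using surj by blast
    obtain k where "a k = g" using g(1) ah(2) by (metis bij_betw_def imageE)
    then show ?thesis using h g by (auto simp: c_def)
  qed
  then have "c 1 \<noteq> 0" by (metis cmult mult_zero_right zero_neq_one)
  show ?thesis
  proof (rule inj_onI)
    fix x y assume xy: "x \<in> carrier G" "y \<in> carrier G" "r x = r y"
    obtain k l where kl: "x = a k" "y = a l" using xy ah(2) by (metis bij_betw_def imageE)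
    then have "c k = c l" using xy by (simp add: c_def)
    then have "k = l" using \<open>c 1 \<noteq> 0\<close> cmult by (metis mult_cancel_right)
    then show "x = y" using kl by simp
  qed
qed

section \<open>Simplices and books\<close>

lemma continuous_on_coordinate: "continuous_on S (\<lambda>x :: 'a \<Rightarrow> real. x v)"
  by (rule continuous_on_product_then_coordinatewise[OF continuous_on_id])

lemma continuous_on_If_const:
  "(b \<Longrightarrow> continuous_on S f) \<Longrightarrow> (\<not> b \<Longrightarrow> continuous_on S g) \<Longrightarrow> continuous_on S (\<lambda>x. if b then f x else g x)"
  by (cases b) simp_all

lemmas coordinate_continuity = continuous_on_If_const continuous_on_coordinate continuous_on_const
  continuous_on_add continuous_on_diff continuous_on_sum continuous_on_min continuous_on_mult
  continuous_on_divide

lemma t1_space_top_of_set_fun: "t1_space (top_of_set (S :: ('a \<Rightarrow> real) set))"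
proof -
  have "t1_space (powertop_real (UNIV :: 'a set))"
    using t1_space_euclidean t1_space_product_topology by blast
  then show ?thesis by (simp add: euclidean_product_topology t1_space_subtopology)
qed

lemma open_positive_coordinates:
  "finite \<sigma> \<Longrightarrow> open {x :: 'a \<Rightarrow> real. \<forall>v\<in>\<sigma>. 0 < x v}"
proof -
  assume "finite \<sigma>"
  then have "open (\<Inter>v\<in>\<sigma>. {x :: 'a \<Rightarrow> real. 0 < x v})"
    by (intro open_INT ballI open_Collect_less continuous_on_coordinate continuous_on_const) auto
  moreover have "(\<Inter>v\<in>\<sigma>. {x :: 'a \<Rightarrow> real. 0 < x v}) = {x. \<forall>v\<in>\<sigma>. 0 < x v}" by auto
  ultimately show ?thesis by simp
qed

section \<open>Geometric simplices in barycentric coordinates\<close>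

definition simplex_points :: "'a set \<Rightarrow> ('a \<Rightarrow> real) set" where
  "simplex_points \<sigma> = {x. (\<forall>v. 0 \<le> x v) \<and> (\<forall>v. v \<notin> \<sigma> \<longrightarrow> x v = 0) \<and> (\<Sum>v\<in>\<sigma>. x v) = 1}"

text \<open>This passes from the product topology to the type-class topology on functions, where
  continuity is expressed by \<open>continuous_on\<close>.\<close>

lemma geometric_realization_eq: "geometric_realization L = top_of_set (\<Union>\<sigma>\<in>L. simplex_points \<sigma>)"
proof -
  have "(\<Union>\<sigma>\<in>L. simplex_points \<sigma>) =
    {x. \<exists>\<sigma> \<in> L. (\<forall>v. 0 \<le> x v) \<and> (\<forall>v. v \<notin> \<sigma> \<longrightarrow> x v = 0) \<and> (\<Sum>v\<in>\<sigma>. x v) = 1}"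
    by (auto simp: simplex_points_def)
  then show ?thesis unfolding geometric_realization_def by (simp only: euclidean_product_topology)
qed

lemma simplex_points_mono:
  assumes "\<sigma> \<subseteq> \<tau>" "finite \<tau>"
  shows "simplex_points \<sigma> \<subseteq> simplex_points \<tau>"
proof
  fix x assume x: "x \<in> simplex_points \<sigma>"
  then have "sum x \<sigma> = sum x \<tau>" using assms by (intro sum.mono_neutral_left) (simp_all add: simplex_points_def)
  moreover have "\<forall>v. v \<notin> \<tau> \<longrightarrow> x v = 0" using x assms(1) by (auto simp: simplex_points_def)
  ultimately show "x \<in> simplex_points \<tau>" using x by (simp add: simplex_points_def)
qed

abbreviation local_homology :: "int \<Rightarrow> ('a \<Rightarrow> real) set \<Rightarrow> ('a \<Rightarrow> real) \<Rightarrow> ('a \<Rightarrow> real) chain set monoid" where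
  "local_homology i S p \<equiv> relative_homology_group i (top_of_set S) (S - {p})"

text \<open>The points with positive coordinates on \<open>\<sigma>\<close> form an open set;
  dropping one barycentric coordinate is a chart from it onto an open simplex in Euclidean
  \<open>k\<close>-space.\<close>

lemma local_homology_simplex_interior:
  fixes \<sigma> :: "'a set"
  assumes fin: "finite \<sigma>" and card: "card \<sigma> = Suc k" and p: "p \<in> simplex_points \<sigma>" "\<And>v. v \<in> \<sigma> \<Longrightarrow> 0 < p v"
  shows "local_homology i (simplex_points \<sigma>) p \<cong> reduced_homology_group i (nsphere k)"
proof -
  define U where "U = simplex_points \<sigma> \<inter> {x. \<forall>v\<in>\<sigma>. 0 < x v}"
  have U: "openin (top_of_set (simplex_points \<sigma>)) U"
    unfolding U_def by (intro openin_open_Int open_positive_coordinates fin)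
  obtain v0 where v0: "v0 \<in> \<sigma>" using card by fastforce
  have "card (\<sigma> - {v0}) = k" using card v0 by simp
  then obtain e where e: "bij_betw e {..<k} (\<sigma> - {v0})"
    using fin ex_bij_betw_nat_finite[of "\<sigma> - {v0}"] by (auto simp: atLeast0LessThan)
  define e' where "e' = the_inv_into {..<k} e"
  have e'e: "e' (e i) = i" if "i < k" for i
    using e that by (auto simp: e'_def bij_betw_def the_inv_into_f_f)
  have ee': "e (e' v) = v" "e' v < k" if "v \<in> \<sigma>" "v \<noteq> v0" for v
    using e that f_the_inv_into_f[of e "{..<k}" v] the_inv_into_into[of e "{..<k}" v "{..<k}"]
    by (auto simp: e'_def bij_betw_def)
  have emem: "e i \<in> \<sigma>" "e i \<noteq> v0" if "i < k" for i
    using e that by (auto simp: bij_betw_def)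
  have sum_e: "(\<Sum>v\<in>\<sigma>. h v) = h v0 + (\<Sum>i<k. h (e i))" for h :: "'a \<Rightarrow> real"
    using sum.reindex_bij_betw[OF e, of h] by (simp add: sum.remove[OF fin v0])
  define V where "V = topspace (Euclidean_space k) \<inter> ((\<Inter>i<k. {y. 0 < y i}) \<inter> {y. (\<Sum>i<k. y i) < 1})"
  have ES: "Euclidean_space k = top_of_set (topspace (Euclidean_space k))"
    by (simp add: Euclidean_space_def euclidean_product_topology)
  have V: "openin (Euclidean_space k) V"
    unfolding V_def by (subst ES, intro openin_open_Int open_Int open_INT ballI open_Collect_less
      continuous_on_coordinate continuous_on_const continuous_on_sum) auto
  define f where "f = (\<lambda>(x :: 'a \<Rightarrow> real) i. if i < k then x (e i) else 0)"
  \<comment> \<open>The dropped coordinate at \<open>v0\<close> is restored from the condition that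
    the coordinates sum to 1.\<close>
  define g where "g = (\<lambda>y v. if v = v0 then 1 - (\<Sum>i<k. y i) else if v \<in> \<sigma> then y (e' v) else (0::real))"
  have cf: "continuous_on S f" for S unfolding f_def
    by (rule continuous_on_coordinatewise_then_product)
      (auto intro!: coordinate_continuity)
  have cg: "continuous_on S g" for S unfolding g_def
    by (rule continuous_on_coordinatewise_then_product)
      (auto intro!: coordinate_continuity)
  have fU: "f x \<in> V" if "x \<in> U" for x
    using that v0 emem sum_e[of x] by (auto simp: U_def V_def f_def topspace_Euclidean_space simplex_points_def)
  have sg: "(\<Sum>v\<in>\<sigma>. g y v) = 1" for y
  proof -
    have "(\<Sum>i<k. g y (e i)) = (\<Sum>i<k. y i)" using emem e'e by (intro sum.cong) (auto simp: g_def)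
    then show ?thesis by (simp add: sum_e) (simp add: g_def)
  qed
  have gV: "g y \<in> U" if "y \<in> V" for y
  proof -
    have "0 < g y v" if "v \<in> \<sigma>" for v using that \<open>y \<in> V\<close> ee' by (auto simp: g_def V_def)
    moreover have "g y v = 0" if "v \<notin> \<sigma>" for v using that v0 by (auto simp: g_def)
    ultimately show ?thesis using sg[of y] by (auto simp: U_def simplex_points_def) (metis less_eq_real_def)
  qed
  have gf: "g (f x) = x" if "x \<in> U" for x
  proof
    fix v
    have s: "(\<Sum>i<k. f x i) = 1 - x v0" using that sum_e[of x] by (simp add: U_def simplex_points_def f_def)
    show "g (f x) v = x v" using that ee' by (auto simp: g_def s) (auto simp: f_def U_def simplex_points_def)
  qed
  have fg: "f (g y) = y" if "y \<in> V" for y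
    using that emem e'e by (auto simp: f_def g_def V_def topspace_Euclidean_space)
  have "subtopology (top_of_set (simplex_points \<sigma>)) U homeomorphic_space subtopology (Euclidean_space k) V"
  proof -
    have "subtopology (top_of_set (simplex_points \<sigma>)) U = top_of_set U"
      by (simp add: subtopology_subtopology U_def Int_absorb1)
    moreover have "subtopology (Euclidean_space k) V = top_of_set V"
      by (subst ES, subst subtopology_subtopology) (simp add: V_def Int_absorb1)
    moreover have "homeomorphic_maps (top_of_set U) (top_of_set V) f g"
      using cf cg fU gV gf fg by (auto simp: homeomorphic_maps_def)
    ultimately show ?thesis unfolding homeomorphic_space_def by metis
  qed
  moreover have "p \<in> U" using p by (simp add: U_def)
  ultimately have "relative_homology_group i (top_of_set (simplex_points \<sigma>))
      (topspace (top_of_set (simplex_points \<sigma>)) - {p}) \<cong> reduced_homology_group i (nsphere k)"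
    by (intro local_homology_chart[OF t1_space_top_of_set_fun U _ V])
  then show ?thesis by (simp only: topspace_euclidean_subtopology)
qed

text \<open>The star of a simplex \<open>\<sigma>\<close> whose link is the discrete complex \<open>W\<close>.\<close>

definition book :: "'a set \<Rightarrow> 'a set \<Rightarrow> ('a \<Rightarrow> real) set" where
  "book \<sigma> W = (\<Union>w\<in>W. simplex_points (insert w \<sigma>))"

text \<open>Such a \<open>p\<close> lies in the relative interior of the simplex shared by all
  pages.\<close>

definition spine_point :: "'a set \<Rightarrow> ('a \<Rightarrow> real) \<Rightarrow> bool" where
  "spine_point \<sigma> p \<longleftrightarrow> p \<in> simplex_points \<sigma> \<and> (\<forall>v\<in>\<sigma>. 0 < p v)"

text \<open>The straight-line homotopy to the apex \<open>w\<close> contracts the page, and also the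
  page without \<open>p\<close>: the \<open>w\<close>-coordinate of \<open>p\<close> is 0, while the
  homotopy makes that coordinate positive at once.\<close>

lemma local_homology_book_one:
  assumes w: "w \<notin> \<sigma>" "finite \<sigma>" and p: "spine_point \<sigma> p"
  shows "trivial_group (local_homology i (book \<sigma> {w}) p)"
proof -
  define S where "S = simplex_points (insert w \<sigma>)"
  define a where "a = (\<lambda>v. if v = w then 1 else 0 :: real)"
  define h where "h = (\<lambda>(t, x :: 'a \<Rightarrow> real) v. (1 - t) * x v + t * a v)"
  have pw: "p w = 0" using p w by (auto simp: spine_point_def simplex_points_def)
  have sa: "(\<Sum>v\<in>\<sigma>. a v) = 0" using w by (intro sum.neutral) (auto simp: a_def)
  have aS: "a \<in> S" using w sa by (auto simp: S_def simplex_points_def) (auto simp: a_def)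
  have ap: "a \<noteq> p" using pw by (auto simp: a_def fun_eq_iff)
  have hS: "h (t, x) \<in> S" if "0 \<le> t" "t \<le> 1" "x \<in> S" for t x
  proof -
    have "(\<Sum>v\<in>insert w \<sigma>. h (t, x) v) = (1 - t) * (\<Sum>v\<in>insert w \<sigma>. x v) + t * (\<Sum>v\<in>insert w \<sigma>. a v)"
      unfolding h_def by (simp only: prod.case sum.distrib sum_distrib_left)
    then show ?thesis using that aS
      by (auto simp: S_def simplex_points_def) (auto simp: h_def a_def)
  qed
  have hp: "h (t, x) \<noteq> p" if "0 \<le> t" "t \<le> 1" "x \<in> S" "x \<noteq> p" for t x
  proof
    assume eq: "h (t, x) = p"
    have "(1 - t) * x w + t = 0" using pw fun_cong[OF eq, of w]
      by (simp add: h_def a_def)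
    moreover have "0 \<le> x w" using that by (auto simp: S_def simplex_points_def)
    ultimately have "t = 0" using that by (smt (verit) mult_nonneg_nonneg)
    then have "h (t, x) = x" by (simp add: h_def)
    then show False using eq that by simp
  qed
  have cs: "continuous_on T (\<lambda>z :: real \<times> ('a \<Rightarrow> real). snd z v)" for T v
    by (rule continuous_on_product_then_coordinatewise[OF continuous_on_snd[OF continuous_on_id]])
  have ch: "continuous_on T h" for T
    unfolding h_def case_prod_unfold
    by (rule continuous_on_coordinatewise_then_product)
      (intro continuous_on_const continuous_on_add continuous_on_diff continuous_on_mult
        continuous_on_fst[OF continuous_on_id] cs)
  have contr: "contractible_space (top_of_set T)" if T: "\<And>t x. 0 \<le> t \<Longrightarrow> t \<le> 1 \<Longrightarrow> x \<in> T \<Longrightarrow> h (t, x) \<in> T" for T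
    unfolding contractible_space_def homotopic_with_def
  proof (intro exI conjI)
    show "continuous_map (prod_topology (top_of_set {0..1}) (top_of_set T)) (top_of_set T) h"
      using T ch by (auto simp: prod_topology_subtopology_eu)
    show "\<forall>x. h (0, x) = id x" by (simp add: h_def)
    show "\<forall>x. h (1, x) = a" by (simp add: h_def)
  qed auto
  have "contractible_space (top_of_set S)" by (rule contr) (rule hS)
  moreover have "contractible_space (top_of_set (S - {p}))" by (rule contr) (use hS hp in auto)
  ultimately have "trivial_group (relative_homology_group i (top_of_set S) (S - {p}))"
    using aS ap by (intro trivial_relative_homology_group_contractible_spaces)
      (auto simp: subtopology_subtopology Int_absorb1)
  then show ?thesis by (simp add: book_def S_def)
qed

text \<open>Two pages glued along \<open>\<sigma>\<close> form a simplex in which a vertex \<open>v0\<close> of \<open>\<sigma>\<close> has become the midpoint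
  of the edge joining the apices.\<close>

lemma local_homology_book_two:
  assumes w: "w1 \<notin> \<sigma>" "w2 \<notin> \<sigma>" "w1 \<noteq> w2" and \<sigma>: "finite \<sigma>" "card \<sigma> = n" "n \<ge> 1" and p: "spine_point \<sigma> p"
  shows "local_homology i (book \<sigma> {w1, w2}) p \<cong> reduced_homology_group i (nsphere n)"
proof -
  obtain v0 where v0: "v0 \<in> \<sigma>" using \<sigma> by fastforce
  define \<tau> where "\<tau> = \<sigma> - {v0}"
  have \<tau>: "\<sigma> = insert v0 \<tau>" "v0 \<notin> \<tau>" "finite \<tau>" "w1 \<notin> \<tau>" "w2 \<notin> \<tau>" "v0 \<noteq> w1" "v0 \<noteq> w2"
    using v0 \<sigma> w by (auto simp: \<tau>_def)
  have card: "card (insert w1 (insert w2 \<tau>)) = Suc n"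
    using \<tau> w \<sigma> by simp
  define S where "S = book \<sigma> {w1, w2}"
  define T where "T = simplex_points (insert w1 (insert w2 \<tau>))"
  \<comment> \<open>\<open>f\<close> moves half of the weight of \<open>v0\<close> to each apex. On
    the book one apex has weight 0, so \<open>g\<close> recovers the weight of \<open>v0\<close> as
    twice the smaller apex weight.\<close>
  define f where "f = (\<lambda>x v. if v = w1 then x w1 + x v0 / 2 else if v = w2 then x w2 + x v0 / 2
    else if v = v0 then 0 else x v :: real)"
  define g where "g = (\<lambda>y v. if v = w1 then y w1 - min (y w1) (y w2) else if v = w2 then y w2 - min (y w1) (y w2)
    else if v = v0 then 2 * min (y w1) (y w2) else y v :: real)"
  \<comment> \<open>The union of the two pages is described by one condition, without a choice of
    page.\<close>
  have S_iff: "x \<in> S \<longleftrightarrow> (\<forall>v. 0 \<le> x v) \<and> (\<forall>v. v \<notin> \<tau> \<longrightarrow> v \<noteq> v0 \<longrightarrow> v \<noteq> w1 \<longrightarrow> v \<noteq> w2 \<longrightarrow> x v = 0) \<and>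
      (x w1 = 0 \<or> x w2 = 0) \<and> x w1 + x w2 + x v0 + (\<Sum>v\<in>\<tau>. x v) = 1" (is "_ \<longleftrightarrow> ?R x") for x
  proof -
    have page: "x \<in> simplex_points (insert u \<sigma>) \<longleftrightarrow> (\<forall>v. 0 \<le> x v) \<and>
        (\<forall>v. v \<notin> \<tau> \<longrightarrow> v \<noteq> v0 \<longrightarrow> v \<noteq> u \<longrightarrow> x v = 0) \<and> x u + x v0 + (\<Sum>v\<in>\<tau>. x v) = 1"
      if "u \<notin> \<tau>" "u \<noteq> v0" for u
      using that \<tau>(2,3) unfolding simplex_points_def \<tau>(1) by (simp add: add.assoc) blast
    have "x \<in> S \<longleftrightarrow> x \<in> simplex_points (insert w1 \<sigma>) \<or> x \<in> simplex_points (insert w2 \<sigma>)"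
      by (simp add: S_def book_def)
    also have "\<dots> \<longleftrightarrow> ?R x"
    proof (intro iffI; (elim disjE)?)
      assume "x \<in> simplex_points (insert w1 \<sigma>)"
      then have 1: "\<forall>v. 0 \<le> x v" "\<forall>v. v \<notin> \<tau> \<longrightarrow> v \<noteq> v0 \<longrightarrow> v \<noteq> w1 \<longrightarrow> x v = 0" "x w1 + x v0 + (\<Sum>v\<in>\<tau>. x v) = 1"
        using page[of w1] \<tau> by auto
      then have "x w2 = 0" using \<tau> w by metis
      then show "?R x" using 1 by simp
    next
      assume "x \<in> simplex_points (insert w2 \<sigma>)"
      then have 1: "\<forall>v. 0 \<le> x v" "\<forall>v. v \<notin> \<tau> \<longrightarrow> v \<noteq> v0 \<longrightarrow> v \<noteq> w2 \<longrightarrow> x v = 0" "x w2 + x v0 + (\<Sum>v\<in>\<tau>. x v) = 1"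
        using page[of w2] \<tau> by auto
      then have "x w1 = 0" using \<tau> w by metis
      then show "?R x" using 1 by simp
    next
      assume R: "?R x"
      show "x \<in> simplex_points (insert w1 \<sigma>) \<or> x \<in> simplex_points (insert w2 \<sigma>)"
      proof (cases "x w2 = 0")
        case True
        then have "x \<in> simplex_points (insert w1 \<sigma>)" using R \<tau> by (subst page) (simp_all, metis)
        then show ?thesis by blast
      next
        case False
        then have "x w1 = 0" using R by blast
        then have "x \<in> simplex_points (insert w2 \<sigma>)" using R \<tau> by (subst page) (simp_all, metis)
        then show ?thesis by blast
      qed
    qed
    finally show ?thesis .
  qed
  have T_iff: "x \<in> T \<longleftrightarrow> (\<forall>v. 0 \<le> x v) \<and> (\<forall>v. v \<notin> \<tau> \<longrightarrow> v \<noteq> w1 \<longrightarrow> v \<noteq> w2 \<longrightarrow> x v = 0) \<and>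
      x w1 + x w2 + (\<Sum>v\<in>\<tau>. x v) = 1" for x
    using \<tau>(3-5) w(3) unfolding T_def simplex_points_def by (simp add: add.assoc) blast
  have sf: "(\<Sum>v\<in>\<tau>. f x v) = (\<Sum>v\<in>\<tau>. x v)" for x using \<tau> by (intro sum.cong) (auto simp: f_def)
  have sg: "(\<Sum>v\<in>\<tau>. g x v) = (\<Sum>v\<in>\<tau>. x v)" for x using \<tau> by (intro sum.cong) (auto simp: g_def)
  have fS: "f x \<in> T" if "x \<in> S" for x
    using that unfolding T_iff S_iff sf using \<tau> w by (auto simp: f_def)
  have gT: "g y \<in> S" if "y \<in> T" for y
    using that unfolding T_iff S_iff sg using \<tau> w by (auto simp: g_def min_def)
  have gf: "g (f x) = x" if "x \<in> S" for x
  proof -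
    have "min (x w1) (x w2) = 0" using that by (auto simp: S_iff)
    moreover have "min (f x w1) (f x w2) = min (x w1) (x w2) + x v0 / 2" using w by (auto simp: f_def)
    ultimately have m: "min (f x w1) (f x w2) = x v0 / 2" by simp
    show ?thesis unfolding g_def m using \<tau> w by (auto simp: f_def)
  qed
  have fg: "f (g y) = y" if "y \<in> T" for y
    using that \<tau> w by (auto simp: f_def g_def T_iff fun_eq_iff)
  have cf: "continuous_on A f" for A unfolding f_def
    by (rule continuous_on_coordinatewise_then_product)
      (auto intro!: coordinate_continuity)
  have cg: "continuous_on A g" for A unfolding g_def
    by (rule continuous_on_coordinatewise_then_product)
      (auto intro!: coordinate_continuity)
  have pS: "p \<in> S"
    using p simplex_points_mono[of \<sigma> "insert w1 \<sigma>"] \<sigma> by (auto simp: S_def book_def spine_point_def)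
  have pw: "p w1 = 0" "p w2 = 0" using p w by (auto simp: spine_point_def simplex_points_def)
  have "homeomorphic_maps (top_of_set S) (top_of_set T) f g"
    using cf cg fS gT gf fg by (auto simp: homeomorphic_maps_def)
  then have "local_homology i S p \<cong> local_homology i T (f p)"
    using homeomorphic_space_relative_homology[of "top_of_set S" "top_of_set T" f g p i] pS by simp
  also have "\<dots> \<cong> reduced_homology_group i (nsphere n)"
    unfolding T_def
  proof (rule local_homology_simplex_interior[OF _ card])
    show "f p \<in> simplex_points (insert w1 (insert w2 \<tau>))" using fS[OF pS] by (simp add: T_def)
    \<comment> \<open>Both apices receive \<open>p v0 / 2\<close>, so the spine point becomes an
      interior point of the simplex.\<close>
    show "0 < f p v" if "v \<in> insert w1 (insert w2 \<tau>)" for v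
      using that p \<tau> w pw by (auto simp: f_def spine_point_def)
  qed (use \<tau> in simp)
  finally show ?thesis by (simp add: S_def)
qed


section \<open>Folding the pages of a book\<close>

lemma hom_induced_left_inverse:
  assumes "continuous_map X Y f" "f \<in> S \<rightarrow> T" "continuous_map Y X g" "g \<in> T \<rightarrow> S"
    and gf: "\<And>x. x \<in> topspace X \<Longrightarrow> g (f x) = x" and c: "c \<in> carrier (relative_homology_group i X S)"
  shows "hom_induced i Y T X S g (hom_induced i X S Y T f c) = c"
  unfolding hom_induced_compose'[OF assms(1-4)]
  using assms by (intro hom_induced_id_gen) (auto intro: continuous_map_compose)

text \<open>On a page at most one apex has nonzero weight, so the sum reads that weight off without
  a choice of page and continuity is immediate. For distinct apices \<open>a\<close> and
  \<open>b\<close>, the page of \<open>b\<close> stays fixed and every other page is laid onto that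
  of \<open>a\<close>.\<close>

definition fold_pages :: "'a \<Rightarrow> 'a \<Rightarrow> 'a set \<Rightarrow> ('a \<Rightarrow> real) \<Rightarrow> 'a \<Rightarrow> real" where
  "fold_pages a b W x = (\<lambda>v. if v = a then \<Sum>w\<in>W - {b}. x w else if v \<in> W - {b} then 0 else x v)"

context
  fixes \<sigma> W :: "'a set" and p :: "'a \<Rightarrow> real"
  assumes fin: "finite \<sigma>" "finite W" and disj: "W \<inter> \<sigma> = {}" and p: "spine_point \<sigma> p"
begin

lemma fold_pages_page:
  assumes x: "x \<in> simplex_points (insert w \<sigma>)" and w: "w \<in> W" "w \<noteq> b" and a: "a \<in> W"
  shows "fold_pages a b W x = (\<lambda>v. if v = a then x w else if v = w then 0 else x v)"
proof -
  have z: "x v = 0" if "v \<in> W" "v \<noteq> w" for v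
    using x that disj by (auto simp: simplex_points_def)
  have "(\<Sum>v\<in>W - {b}. x v) = (\<Sum>v\<in>{w}. x v)"
    using fin w z by (intro sum.mono_neutral_right) auto
  then show ?thesis using w z unfolding fold_pages_def fun_eq_iff by auto
qed

lemma fold_pages_mem:
  assumes x: "x \<in> simplex_points (insert w \<sigma>)" and w: "w \<in> W" "w \<noteq> b" and a: "a \<in> W"
  shows "fold_pages a b W x \<in> simplex_points (insert a \<sigma>)"
proof -
  have nw: "w \<notin> \<sigma>" "a \<notin> \<sigma>" using disj w a by auto
  have "(\<Sum>v\<in>\<sigma>. if v = a then x w else if v = w then 0 else x v) = (\<Sum>v\<in>\<sigma>. x v)"
    using nw by (intro sum.cong) auto
  then show ?thesis unfolding fold_pages_page[OF assms]
    using x nw fin by (auto simp: simplex_points_def)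
qed

lemma fold_pages_id_back:
  assumes x: "x \<in> simplex_points (insert b \<sigma>)" and ab: "a \<in> W" "b \<in> W" "a \<noteq> b"
  shows "fold_pages a b W x = x"
proof -
  have z: "x v = 0" if "v \<in> W" "v \<noteq> b" for v
    using x that disj by (auto simp: simplex_points_def)
  then have "(\<Sum>v\<in>W - {b}. x v) = 0" by (intro sum.neutral) auto
  then show ?thesis using ab z unfolding fold_pages_def fun_eq_iff by auto
qed

lemma fold_pages_id_front:
  assumes x: "x \<in> simplex_points (insert a \<sigma>)" and ab: "a \<in> W" "b \<in> W" "a \<noteq> b"
  shows "fold_pages a b W x = x"
  unfolding fold_pages_page[OF x ab(1,3) ab(1)] by auto

lemma fold_pages_id:
  "x \<in> book \<sigma> {a, b} \<Longrightarrow> a \<in> W \<Longrightarrow> b \<in> W \<Longrightarrow> a \<noteq> b \<Longrightarrow> fold_pages a b W x = x"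
  using fold_pages_id_front fold_pages_id_back by (auto simp: book_def)

text \<open>On the page of \<open>b\<close> folding is the identity. On any other page a point
  folded to \<open>p\<close> has apex weight 0, because \<open>p\<close> has, so it was not
  moved.\<close>

lemma fold_pages_neq_spine_point:
  assumes x: "x \<in> book \<sigma> W" and ab: "a \<in> W" "b \<in> W" "a \<noteq> b" and ne: "x \<noteq> p"
  shows "fold_pages a b W x \<noteq> p"
proof
  assume eq: "fold_pages a b W x = p"
  obtain w where w: "w \<in> W" "x \<in> simplex_points (insert w \<sigma>)" using x by (auto simp: book_def)
  have p0: "p v = 0" if "v \<notin> \<sigma>" for v using p that by (auto simp: spine_point_def simplex_points_def)
  show False
  proof (cases "w = b")
    case True
    then show False using fold_pages_id_back w ab eq ne by metis
  next
    case False
    note f = fold_pages_page[OF w(2,1) False ab(1)]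
    have "a \<notin> \<sigma>" using ab disj by blast
    then have "x w = 0" using fun_cong[OF f, of a] p0[of a] eq by simp
    have "x v = p v" for v
    proof (cases "v = a \<or> v = w")
      case True
      then have "v \<notin> \<sigma>" using ab w disj by blast
      moreover have "x v = 0"
        using True \<open>x w = 0\<close> w(2) \<open>v \<notin> \<sigma>\<close> by (cases "v = w") (auto simp: simplex_points_def)
      ultimately show ?thesis using p0 by simp
    next
      case False
      then show ?thesis using fun_cong[OF f, of v] eq by simp
    qed
    then show False using ne by blast
  qed
qed

lemma fold_pages_book:
  assumes "x \<in> book \<sigma> W" and "a \<in> W" "b \<in> W" "a \<noteq> b"
  shows "fold_pages a b W x \<in> book \<sigma> {a, b}"
proof -
  obtain w where w: "w \<in> W" "x \<in> simplex_points (insert w \<sigma>)" using assms by (auto simp: book_def)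
  then show ?thesis
    using fold_pages_mem[OF w(2,1), of b a] fold_pages_id_back[of x b a] assms by (cases "w = b") (auto simp: book_def)
qed

lemma continuous_on_fold_pages: "continuous_on A (fold_pages a b W)"
  unfolding fold_pages_def
  by (rule continuous_on_coordinatewise_then_product) (auto intro!: coordinate_continuity)

lemma book_mono: "W1 \<subseteq> W2 \<Longrightarrow> book \<sigma> W1 \<subseteq> book \<sigma> W2"
  by (auto simp: book_def)

text \<open>Folding all other pages onto the page of \<open>a\<close> would be injective on local homology if that were
  infinite cyclic, but it kills the homology carried by the pages of \<open>a\<close> and a third apex \<open>c\<close>.\<close>

lemma local_homology_book_many:
  assumes n: "card \<sigma> = n" "n \<ge> 1" and W: "card W \<ge> 3"
  shows "\<not> local_homology n (book \<sigma> W) p \<cong> integer_group"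
proof
  assume Z: "local_homology n (book \<sigma> W) p \<cong> integer_group"
  obtain a b c where abc: "a \<in> W" "b \<in> W" "c \<in> W" "a \<noteq> b" "a \<noteq> c" "b \<noteq> c"
  proof -
    obtain T where T: "T \<subseteq> W" "card T = 3" using obtain_subset_with_card_n[OF W] by metis
    then show ?thesis using that by (auto simp: card_3_iff)
  qed
  let ?H = "\<lambda>U. relative_homology_group n (top_of_set (book \<sigma> U)) (book \<sigma> U - {p})"
  let ?h = "\<lambda>U U'. hom_induced n (top_of_set (book \<sigma> U)) (book \<sigma> U - {p}) (top_of_set (book \<sigma> U')) (book \<sigma> U' - {p})"
  have two: "?H {a, y} \<cong> integer_group" if "y \<in> W" "a \<noteq> y" for y
  proof -
    have "?H {a, y} \<cong> reduced_homology_group n (nsphere n)"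
      using abc that disj fin n p by (intro local_homology_book_two) auto
    then show ?thesis using reduced_homology_group_nsphere(1) iso_trans by blast
  qed
  have one_H: "\<one>\<^bsub>?H U\<^esub> \<in> carrier (?H U)" for U
    by (rule monoid.one_closed[OF group.is_monoid[OF group_relative_homology_group]])
  have incl: "continuous_map (top_of_set (book \<sigma> U)) (top_of_set (book \<sigma> U')) id"
    "id \<in> (book \<sigma> U - {p}) \<rightarrow> (book \<sigma> U' - {p})" if "U \<subseteq> U'" for U U'
    using book_mono[OF that] by auto
  have fold: "continuous_map (top_of_set (book \<sigma> W)) (top_of_set (book \<sigma> {a, y})) (fold_pages a y W)"
    "fold_pages a y W \<in> (book \<sigma> W - {p}) \<rightarrow> (book \<sigma> {a, y} - {p})" if "y \<in> W" "a \<noteq> y" for y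
    using fold_pages_book fold_pages_neq_spine_point continuous_on_fold_pages abc that by auto
  \<comment> \<open>Folding fixes the pages of \<open>a\<close> and \<open>y\<close>, so on homology
    it is left inverse to the inclusion.\<close>
  have retract: "?h W {a, y} (fold_pages a y W) (?h {a, y} W id d) = d"
    if "y \<in> W" "a \<noteq> y" "d \<in> carrier (?H {a, y})" for y d
    using that abc fold_pages_id[of _ a y] by (intro hom_induced_left_inverse incl fold) auto
  \<comment> \<open>By \<open>retract\<close> the folding map is onto; as both groups are infinite
    cyclic, it is injective.\<close>
  have inj: "inj_on (?h W {a, b} (fold_pages a b W)) (carrier (?H W))"
  proof (rule epi_integer_groups_inj[OF Z two])
    show "carrier (?H {a, b}) \<subseteq> ?h W {a, b} (fold_pages a b W) ` carrier (?H W)"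
    proof
      fix d assume "d \<in> carrier (?H {a, b})"
      then have "d = ?h W {a, b} (fold_pages a b W) (?h {a, b} W id d)" using retract[of b d] abc by simp
      then show "d \<in> ?h W {a, b} (fold_pages a b W) ` carrier (?H W)"
        using hom_induced_carrier by blast
    qed
  qed (use abc in \<open>auto simp: hom_induced_hom\<close>)
  have "d = \<one>\<^bsub>?H {a, c}\<^esub>" if d: "d \<in> carrier (?H {a, c})" for d
  proof -
    \<comment> \<open>This folding lays the page of \<open>c\<close> onto that of \<open>a\<close>,
      so its restriction to the pages of \<open>a\<close> and \<open>c\<close> factors through a
      single page.\<close>
    have fa: "continuous_map (top_of_set (book \<sigma> {a, c})) (top_of_set (book \<sigma> {a})) (fold_pages a b W)"
      "fold_pages a b W \<in> (book \<sigma> {a, c} - {p}) \<rightarrow> (book \<sigma> {a} - {p})"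
    proof -
      have "fold_pages a b W x \<in> book \<sigma> {a}" if "x \<in> book \<sigma> {a, c}" for x
        using that abc fold_pages_mem[of x a b a] fold_pages_mem[of x c b a] by (auto simp: book_def)
      moreover have "fold_pages a b W x \<noteq> p" if "x \<in> book \<sigma> {a, c} - {p}" for x
        using that abc fold_pages_neq_spine_point[of x a b] book_mono[of "{a, c}" W] by auto
      ultimately show "continuous_map (top_of_set (book \<sigma> {a, c})) (top_of_set (book \<sigma> {a})) (fold_pages a b W)"
        "fold_pages a b W \<in> (book \<sigma> {a, c} - {p}) \<rightarrow> (book \<sigma> {a} - {p})"
        using continuous_on_fold_pages by auto
    qed
    have "?h W {a, b} (fold_pages a b W) (?h {a, c} W id d) = ?h {a, c} {a, b} (fold_pages a b W \<circ> id) d"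
      using abc by (intro hom_induced_compose' incl fold) auto
    also have "\<dots> = ?h {a, c} {a, b} (id \<circ> fold_pages a b W) d" by simp
    also have "\<dots> = ?h {a} {a, b} id (?h {a, c} {a} (fold_pages a b W) d)"
      by (intro hom_induced_compose'[symmetric] incl fa) auto
    also have "?h {a, c} {a} (fold_pages a b W) d = \<one>\<^bsub>?H {a}\<^esub>"
    proof -
      have "trivial_group (?H {a})" using abc disj fin p by (intro local_homology_book_one) auto
      then have "carrier (?H {a}) = {\<one>\<^bsub>?H {a}\<^esub>}" unfolding trivial_group_def by (rule conjunct2)
      then show ?thesis by (metis hom_induced_carrier singletonD)
    qed
    also have "?h {a} {a, b} id \<one>\<^bsub>?H {a}\<^esub> = \<one>\<^bsub>?H {a, b}\<^esub>"
      by (rule hom_one[OF hom_induced_hom group_relative_homology_group group_relative_homology_group])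
    also have "\<dots> = ?h W {a, b} (fold_pages a b W) \<one>\<^bsub>?H W\<^esub>"
      by (rule hom_one[OF hom_induced_hom group_relative_homology_group group_relative_homology_group, symmetric])
    \<comment> \<open>Injectivity makes the image of \<open>d\<close> in the whole book trivial; the
      folding that keeps the page of \<open>c\<close> then recovers \<open>d\<close> as the
      unit.\<close>
    finally have "?h {a, c} W id d = \<one>\<^bsub>?H W\<^esub>"
      by (rule inj_onD[OF inj _ hom_induced_carrier]) (rule one_H)
    then have "d = ?h W {a, c} (fold_pages a c W) \<one>\<^bsub>?H W\<^esub>" using retract[of c d] abc d by simp
    also have "\<dots> = \<one>\<^bsub>?H {a, c}\<^esub>"
      by (rule hom_one[OF hom_induced_hom group_relative_homology_group group_relative_homology_group])
    finally show ?thesis .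
  qed
  then have "carrier (?H {a, c}) = {\<one>\<^bsub>?H {a, c}\<^esub>}" using one_H[of "{a, c}"] by blast
  then have "trivial_group (?H {a, c})" by (simp only: trivial_group_def group_relative_homology_group simp_thms)
  then show False
    using isomorphic_group_triviality[OF two[of c]] abc nontrivial_integer_group group_integer_group
    by auto
qed

end

section \<open>Homology manifolds and their 1-skeleta\<close>

text \<open>One page has trivial local homology, and three or more pages exclude an infinite cyclic
  group.\<close>

lemma card_pages_eq_2:
  assumes "finite \<sigma>" "finite W" "W \<inter> \<sigma> = {}" "spine_point \<sigma> p" "card \<sigma> = n" "n \<ge> 1" "W \<noteq> {}"
    and Z: "local_homology n (book \<sigma> W) p \<cong> integer_group"
  shows "card W = 2"
proof -
  have "\<not> card W \<ge> 3" using local_homology_book_many[of \<sigma> W p n] assms by blast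
  moreover have "card W \<noteq> 1"
  proof
    assume "card W = 1"
    then obtain w where w: "W = {w}" by (auto simp: card_1_singleton_iff)
    then have "trivial_group (local_homology n (book \<sigma> W) p)"
      using assms local_homology_book_one[of w \<sigma> p n] by simp
    then show False
      using isomorphic_group_triviality[OF Z] nontrivial_integer_group group_integer_group by simp
  qed
  moreover have "card W \<noteq> 0" using assms by simp
  ultimately show ?thesis by linarith
qed

text \<open>The points of \<open>R\<close> with positive coordinates on \<open>\<sigma>\<close> form
  an open neighbourhood of \<open>p\<close> inside \<open>S\<close>, so excision discards the rest
  of \<open>R\<close>.\<close>

lemma local_homology_open_star:
  assumes fin: "finite \<sigma>" and p: "p \<in> R" "\<And>v. v \<in> \<sigma> \<Longrightarrow> 0 < p v" and S: "S \<subseteq> R"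
    and sub: "\<And>x. x \<in> R \<Longrightarrow> (\<And>v. v \<in> \<sigma> \<Longrightarrow> 0 < x v) \<Longrightarrow> x \<in> S"
  shows "local_homology i S p \<cong> local_homology i R p"
proof -
  define U where "U = R \<inter> {x. \<forall>v\<in>\<sigma>. 0 < x v}"
  have U: "openin (top_of_set R) U" unfolding U_def by (intro openin_open_Int open_positive_coordinates fin)
  have "relative_homology_group i (subtopology (top_of_set R) S) (S - {p}) \<cong>
      relative_homology_group i (top_of_set R) (topspace (top_of_set R) - {p})"
    using p S sub by (intro relative_homology_neighbourhood[OF t1_space_top_of_set_fun U]) (auto simp: U_def)
  moreover have "subtopology (top_of_set R) S = top_of_set S"
    using S by (simp add: subtopology_subtopology Int_absorb1)
  ultimately show ?thesis by simp
qed

text \<open>The barycentre is such a point.\<close>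

lemma spine_point_exists:
  assumes "finite \<sigma>" "\<sigma> \<noteq> {}"
  shows "\<exists>p. spine_point \<sigma> p"
proof
  show "spine_point \<sigma> (\<lambda>v. if v \<in> \<sigma> then 1 / card \<sigma> else 0)"
    using assms by (simp add: spine_point_def simplex_points_def card_gt_0_iff)
qed

lemma homology_manifold_iff:
  "homology_manifold n L \<longleftrightarrow> (\<forall>x \<in> (\<Union>\<sigma>\<in>L. simplex_points \<sigma>). \<forall>i.
     local_homology i (\<Union>\<sigma>\<in>L. simplex_points \<sigma>) x \<cong> reduced_homology_group i (nsphere n))"
  unfolding homology_manifold_def geometric_realization_eq Let_def topspace_euclidean_subtopology ..

section \<open>Local combinatorics of a homology manifold\<close>

locale finite_homology_manifold =
  fixes L :: "'a set set" and n :: nat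
  assumes finite_L: "finite L" and complex_L: "abstract_simplicial_complex L"
    and manifold_L: "homology_manifold n L" and n_ge_1: "n \<ge> 1"
begin

lemma simplex: "\<sigma> \<in> L \<Longrightarrow> finite \<sigma>" "\<sigma> \<in> L \<Longrightarrow> \<sigma> \<noteq> {}"
  "\<sigma> \<in> L \<Longrightarrow> \<tau> \<subseteq> \<sigma> \<Longrightarrow> \<tau> \<noteq> {} \<Longrightarrow> \<tau> \<in> L"
  using complex_L unfolding abstract_simplicial_complex_def by blast+

lemma support_subset:
  assumes "x \<in> simplex_points \<tau>" "\<And>v. v \<in> \<sigma> \<Longrightarrow> 0 < x v"
  shows "\<sigma> \<subseteq> \<tau>"
proof
  fix v assume "v \<in> \<sigma>"
  then have "x v \<noteq> 0" using assms(2) by fastforce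
  then show "v \<in> \<tau>" using assms(1) unfolding simplex_points_def by blast
qed

text \<open>Near an interior point of a maximal simplex the realization is that simplex alone, so
  the local homology reveals its dimension.\<close>

lemma card_maximal_simplex:
  assumes \<sigma>: "\<sigma> \<in> L" and max: "\<And>\<tau>. \<tau> \<in> L \<Longrightarrow> \<sigma> \<subseteq> \<tau> \<Longrightarrow> \<tau> = \<sigma>"
  shows "card \<sigma> = Suc n"
proof -
  define R where "R = (\<Union>\<sigma>\<in>L. simplex_points \<sigma>)"
  obtain p where p: "p \<in> simplex_points \<sigma>" "\<And>v. v \<in> \<sigma> \<Longrightarrow> 0 < p v"
    using spine_point_exists[OF simplex(1)[OF \<sigma>] simplex(2)[OF \<sigma>]] unfolding spine_point_def by blast
  have pR: "p \<in> R" using p \<sigma> by (auto simp: R_def)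
  obtain k where k: "card \<sigma> = Suc k" using simplex(1)[OF \<sigma>] simplex(2)[OF \<sigma>] by (metis card_0_eq not0_implies_Suc)
  have "local_homology n (simplex_points \<sigma>) p \<cong> local_homology n R p"
  proof (rule local_homology_open_star[OF simplex(1)[OF \<sigma>] pR p(2)])
    show "simplex_points \<sigma> \<subseteq> R" using \<sigma> by (auto simp: R_def)
    show "x \<in> simplex_points \<sigma>" if "x \<in> R" "\<And>v. v \<in> \<sigma> \<Longrightarrow> 0 < x v" for x
    proof -
      obtain \<tau> where "\<tau> \<in> L" "x \<in> simplex_points \<tau>" using \<open>x \<in> R\<close> by (auto simp: R_def)
      then show ?thesis using max support_subset that(2) by metis
    qed
  qed auto
  also have "\<dots> \<cong> reduced_homology_group n (nsphere n)"
    using bspec[OF manifold_L[unfolded homology_manifold_iff, folded R_def] pR] by (rule spec)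
  finally have "local_homology n (simplex_points \<sigma>) p \<cong> reduced_homology_group n (nsphere n)" .
  moreover have "local_homology n (simplex_points \<sigma>) p \<cong> reduced_homology_group n (nsphere k)"
    using simplex(1)[OF \<sigma>] k p by (intro local_homology_simplex_interior) auto
  \<comment> \<open>Degree \<open>n\<close> suffices: there the reduced homology of the
    \<open>k\<close>-sphere is nontrivial only for \<open>k = n\<close>.\<close>
  ultimately have "trivial_group (reduced_homology_group n (nsphere n)) \<longleftrightarrow>
      trivial_group (reduced_homology_group n (nsphere k))"
    using isomorphic_group_triviality group_relative_homology_group group_reduced_homology_group by metis
  then show ?thesis using k by (simp add: trivial_reduced_homology_group_nsphere)
qed

text \<open>Purity: in a finite complex every simplex extends to a maximal one, whose size is
  already known.\<close>

lemma simplex_in_maximal: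
  assumes "\<sigma> \<in> L"
  shows "\<exists>\<tau>\<in>L. \<sigma> \<subseteq> \<tau> \<and> card \<tau> = Suc n"
proof -
  obtain \<tau> where "\<tau> \<in> L" "\<sigma> \<subseteq> \<tau>" "\<forall>\<rho>\<in>L. \<tau> \<subseteq> \<rho> \<longrightarrow> \<rho> = \<tau>"
    using finite_has_maximal2[OF finite_L assms] by metis
  then show ?thesis using card_maximal_simplex by metis
qed

lemma card_simplex_le: "\<sigma> \<in> L \<Longrightarrow> card \<sigma> \<le> Suc n"
  using simplex_in_maximal simplex(1) card_mono by metis

text \<open>Near an interior point of \<open>\<sigma>\<close> the realization is a book whose pages
  are the facets containing \<open>\<sigma>\<close> and whose apices are the vertices of the
  link.\<close>

lemma card_link_ridge:
  assumes \<sigma>: "\<sigma> \<in> L" and card: "card \<sigma> = n"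
  shows "card {w. w \<notin> \<sigma> \<and> insert w \<sigma> \<in> L} = 2"
proof -
  define R where "R = (\<Union>\<sigma>\<in>L. simplex_points \<sigma>)"
  define W where "W = {w. w \<notin> \<sigma> \<and> insert w \<sigma> \<in> L}"
  have fW: "finite W"
    by (rule finite_subset[of _ "\<Union>L"]) (use finite_L simplex(1) in \<open>auto simp: W_def\<close>)
  obtain p where sp: "spine_point \<sigma> p" using spine_point_exists[OF simplex(1)[OF \<sigma>] simplex(2)[OF \<sigma>]] by blast
  then have p: "p \<in> simplex_points \<sigma>" "\<And>v. v \<in> \<sigma> \<Longrightarrow> 0 < p v" by (auto simp: spine_point_def)
  have pR: "p \<in> R" using p \<sigma> by (auto simp: R_def)
  have above: "\<exists>w\<in>W. \<rho> = insert w \<sigma>" if \<rho>: "\<rho> \<in> L" "\<sigma> \<subseteq> \<rho>" "card \<rho> = Suc n" for \<rho>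
  proof -
    have "card (\<rho> - \<sigma>) = 1" using card \<rho> simplex(1)[OF \<sigma>] by (simp add: card_Diff_subset)
    then obtain w where "\<rho> - \<sigma> = {w}" by (auto simp: card_1_singleton_iff)
    then have "w \<notin> \<sigma>" "\<rho> = insert w \<sigma>" using \<rho> by auto
    then show ?thesis using \<rho> by (auto simp: W_def)
  qed
  have "local_homology n (book \<sigma> W) p \<cong> local_homology n R p"
  proof (rule local_homology_open_star[OF simplex(1)[OF \<sigma>] pR p(2)])
    show "book \<sigma> W \<subseteq> R" by (auto simp: R_def W_def book_def)
    show "x \<in> book \<sigma> W" if "x \<in> R" "\<And>v. v \<in> \<sigma> \<Longrightarrow> 0 < x v" for x
    proof -
      obtain \<tau> where \<tau>: "\<tau> \<in> L" "x \<in> simplex_points \<tau>" using \<open>x \<in> R\<close> by (auto simp: R_def)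
      then have "\<sigma> \<subseteq> \<tau>" using support_subset that(2) by metis
      \<comment> \<open>By purity the simplex \<open>\<tau>\<close> carrying \<open>x\<close>
        extends to a facet, which is a page of the book.\<close>
      obtain \<rho> where \<rho>: "\<rho> \<in> L" "\<tau> \<subseteq> \<rho>" "card \<rho> = Suc n" using simplex_in_maximal[OF \<tau>(1)] by blast
      then have "x \<in> simplex_points \<rho>" using \<tau> simplex_points_mono simplex(1) by blast
      moreover have "\<exists>w\<in>W. \<rho> = insert w \<sigma>" using above[of \<rho>] \<rho> \<open>\<sigma> \<subseteq> \<tau>\<close> by blast
      ultimately show ?thesis by (auto simp: book_def)
    qed
  qed auto
  also have "\<dots> \<cong> reduced_homology_group n (nsphere n)"
    using bspec[OF manifold_L[unfolded homology_manifold_iff, folded R_def] pR] by (rule spec)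
  also have "\<dots> \<cong> integer_group" by (rule reduced_homology_group_nsphere(1))
  finally have Z: "local_homology n (book \<sigma> W) p \<cong> integer_group" .
  have "W \<noteq> {}" using simplex_in_maximal[OF \<sigma>] above by blast
  then show ?thesis
    using card_pages_eq_2[OF simplex(1)[OF \<sigma>] fW _ sp card n_ge_1 _ Z] by (auto simp: W_def)
qed

end

section \<open>From topological manifolds to homology manifolds\<close>

lemma homology_manifold_of_topological_manifold:
  assumes M: "topological_manifold n M" and h: "geometric_realization L homeomorphic_space M"
  shows "homology_manifold n L"
proof -
  define X where "X = geometric_realization L"
  obtain f g where fg: "homeomorphic_maps X M f g" using h unfolding homeomorphic_space_def X_def by blast
  have "relative_homology_group i X (topspace X - {x}) \<cong> reduced_homology_group i (nsphere n)"
    if x: "x \<in> topspace X" for x i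
  proof -
    have "f x \<in> topspace M" using fg x by (auto simp: homeomorphic_maps_def continuous_map_def)
    then obtain U V where UV: "openin M U" "f x \<in> U" "openin (Euclidean_space n) V"
        "subtopology M U homeomorphic_space subtopology (Euclidean_space n) V"
      using M unfolding topological_manifold_def by blast
    have "t1_space M" using M Hausdorff_imp_t1_space unfolding topological_manifold_def by blast
    then have "relative_homology_group i M (topspace M - {f x}) \<cong> reduced_homology_group i (nsphere n)"
      using UV by (rule local_homology_chart)
    then show ?thesis using homeomorphic_space_relative_homology[OF fg x] iso_trans by blast
  qed
  then show ?thesis unfolding homology_manifold_def X_def Let_def by blast
qed

section \<open>Digraph isomorphisms as maps of vertices\<close>

lemma digraph_iso_induced_imp_rel_iso:
  assumes "digraph_iso (with_proj A \<restriction> S) (with_proj B \<restriction> T)"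
  shows "\<exists>g. rel_iso g S (parcs A) T (parcs B)"
proof -
  obtain h where h: "pre_digraph.digraph_isomorphism (with_proj A \<restriction> S) h"
    and eq: "with_proj B \<restriction> T = app_iso h (with_proj A \<restriction> S)"
    using assms by (auto simp: digraph_iso_def)
  define g where "g = iso_verts h"
  define k where "k = iso_arcs h"
  have T: "T = g ` S"
    using arg_cong[OF eq, of verts] by (simp add: g_def)
  have arcs: "{e \<in> parcs B. fst e \<in> T \<and> snd e \<in> T} = k ` {e \<in> parcs A. fst e \<in> S \<and> snd e \<in> S}"
    using arg_cong[OF eq, of arcs] by (simp add: k_def)
  have th: "iso_tail h = fst" "iso_head h = snd"
    using arg_cong[OF eq, of tail] arg_cong[OF eq, of head] by simp_all
  have inj: "inj_on g S" using h by (auto simp: pre_digraph.digraph_isomorphism_def g_def)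
  \<comment> \<open>Tails and heads are the projections on both sides, so the arc map is determined
    by the vertex map.\<close>
  have k: "k (u, v) = (g u, g v)" if "(u, v) \<in> parcs A" "u \<in> S" "v \<in> S" for u v
    using h that by (simp add: pre_digraph.digraph_isomorphism_def g_def k_def th prod_eq_iff)
  have "(u, v) \<in> parcs A \<longleftrightarrow> (g u, g v) \<in> parcs B" if uv: "u \<in> S" "v \<in> S" for u v
  proof
    assume "(u, v) \<in> parcs A"
    then have "k (u, v) \<in> {e \<in> parcs B. fst e \<in> T \<and> snd e \<in> T}" unfolding arcs using uv by auto
    then show "(g u, g v) \<in> parcs B" using k \<open>(u, v) \<in> parcs A\<close> uv by simp
  next
    assume "(g u, g v) \<in> parcs B"
    then have "(g u, g v) \<in> {e \<in> parcs B. fst e \<in> T \<and> snd e \<in> T}" using uv T by auto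
    then obtain u' v' where e: "(u', v') \<in> parcs A" "u' \<in> S" "v' \<in> S" "(g u, g v) = k (u', v')"
      unfolding arcs by auto
    then have "u = u'" "v = v'" using k[of u' v'] inj uv by (auto dest: inj_onD)
    then show "(u, v) \<in> parcs A" using e by simp
  qed
  then show ?thesis using inj T unfolding rel_iso_def bij_betw_def by blast
qed

text \<open>The isomorphism is built from the inverse of \<open>g\<close>, since
  \<open>reconstructible\<close> asks for one from the second graph to the first.\<close>

lemma rel_iso_imp_digraph_iso:
  assumes g: "rel_iso g (pverts A) (parcs A) (pverts B) (parcs B)"
    and A: "pair_wf_digraph A" and B: "pair_wf_digraph B"
  shows "digraph_iso (with_proj B) (with_proj A)"
proof -
  define g' where "g' = the_inv_into (pverts A) g"
  have bij: "bij_betw g (pverts A) (pverts B)"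
    and e: "\<And>u v. u \<in> pverts A \<Longrightarrow> v \<in> pverts A \<Longrightarrow> (u, v) \<in> parcs A \<longleftrightarrow> (g u, g v) \<in> parcs B"
    using g by (auto simp: rel_iso_def)
  have bij': "bij_betw g' (pverts B) (pverts A)" using bij unfolding g'_def by (rule bij_betw_the_inv_into)
  have g'g: "g' (g u) = u" if "u \<in> pverts A" for u
    using that bij by (simp add: g'_def bij_betw_def the_inv_into_f_f)
  have gg': "g (g' u) = u" if "u \<in> pverts B" for u
    using that bij by (metis bij_betw_def f_the_inv_into_f g'_def)
  have inA: "u \<in> pverts A" "v \<in> pverts A" if "(u, v) \<in> parcs A" for u v
    using that pair_wf_digraph.in_arcsD1[OF A] pair_wf_digraph.in_arcsD2[OF A] by blast+
  have inB: "u \<in> pverts B" "v \<in> pverts B" if "(u, v) \<in> parcs B" for u v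
    using that pair_wf_digraph.in_arcsD1[OF B] pair_wf_digraph.in_arcsD2[OF B] by blast+
  have arcs: "map_prod g' g' ` parcs B = parcs A"
  proof (intro equalityI subsetI)
    fix z assume "z \<in> map_prod g' g' ` parcs B"
    then obtain u v where uv: "(u, v) \<in> parcs B" "z = (g' u, g' v)" by auto
    then have "g' u \<in> pverts A" "g' v \<in> pverts A" using bij' inB by (auto simp: bij_betw_def)
    then show "z \<in> parcs A" using uv e gg' inB by simp
  next
    fix z assume "z \<in> parcs A"
    then obtain u v where uv: "(u, v) \<in> parcs A" "z = (u, v)" by (cases z) auto
    have "u \<in> pverts A" "v \<in> pverts A" using inA uv(1) by blast+
    then have "(g u, g v) \<in> parcs B" "z = map_prod g' g' (g u, g v)" using e[of u v] uv g'g by simp_all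
    then show "z \<in> map_prod g' g' ` parcs B" by blast
  qed
  define h where "h = \<lparr>iso_verts = g', iso_arcs = map_prod g' g', iso_head = snd, iso_tail = fst\<rparr>"
  have "inj_on (map_prod g' g') (parcs B)"
    by (rule inj_on_subset[OF map_prod_inj_on[OF bij_betw_imp_inj_on[OF bij'] bij_betw_imp_inj_on[OF bij']]])
      (use inB in auto)
  then have "pre_digraph.digraph_isomorphism (with_proj B) h"
    using bij' B unfolding pre_digraph.digraph_isomorphism_def wf_digraph_wp_iff
    by (auto simp: h_def bij_betw_def)
  moreover have "with_proj A = app_iso h (with_proj B)"
    using bij' arcs by (simp add: app_iso_def h_def with_proj_def bij_betw_def)
  ultimately show ?thesis unfolding digraph_iso_def by blast
qed

section \<open>Flag complexes and the cliques of their 1-skeleta\<close>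

lemma flag_complex_facts:
  assumes "flag_complex L"
  shows "\<sigma> \<in> L \<Longrightarrow> finite \<sigma>"
    and "\<sigma> \<in> L \<Longrightarrow> \<tau> \<subseteq> \<sigma> \<Longrightarrow> \<tau> \<noteq> {} \<Longrightarrow> \<tau> \<in> L"
    and "finite T \<Longrightarrow> T \<noteq> {} \<Longrightarrow> T \<subseteq> \<Union>L \<Longrightarrow> (\<And>u v. u \<in> T \<Longrightarrow> v \<in> T \<Longrightarrow> u \<noteq> v \<Longrightarrow> {u, v} \<in> L) \<Longrightarrow> T \<in> L"
  using assms unfolding flag_complex_def abstract_simplicial_complex_def by blast+

text \<open>Flagness fills every nonempty finite clique by a simplex; \<open>k \<ge> 1\<close>
  excludes the empty set, which is a clique but not a simplex.\<close>

lemma one_skeleton_cliques: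
  assumes L: "flag_complex L" and k: "k \<ge> 1"
  shows "cliques (parcs (one_skeleton L)) k (\<Union>L) = {\<sigma> \<in> L. card \<sigma> = k}"
proof (intro equalityI subsetI)
  fix C assume C: "C \<in> cliques (parcs (one_skeleton L)) k (\<Union>L)"
  then have "C \<noteq> {}" "finite C" using k by (auto simp: cliques_def intro: card_ge_0_finite)
  then show "C \<in> {\<sigma> \<in> L. card \<sigma> = k}"
    using C flag_complex_facts(3)[OF L, of C] by (simp add: cliques_def one_skeleton_def)
next
  fix \<sigma> assume \<sigma>: "\<sigma> \<in> {\<sigma> \<in> L. card \<sigma> = k}"
  have "{u, v} \<in> L" if "u \<in> \<sigma>" "v \<in> \<sigma>" for u v
    by (rule flag_complex_facts(2)[OF L, of \<sigma>]) (use \<sigma> that in auto)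
  then show "\<sigma> \<in> cliques (parcs (one_skeleton L)) k (\<Union>L)"
    using \<sigma> by (auto simp: cliques_def one_skeleton_def)
qed

text \<open>By flagness a vertex joined to all of \<open>\<sigma>\<close> spans a simplex with it,
  so the common neighbours are the vertices of the link.\<close>

lemma one_skeleton_common_nbrs:
  assumes L: "flag_complex L" and \<sigma>: "\<sigma> \<in> L"
  shows "common_nbrs (parcs (one_skeleton L)) (\<Union>L) \<sigma> = {w. w \<notin> \<sigma> \<and> insert w \<sigma> \<in> L}"
proof (intro equalityI subsetI)
  have sub: "\<tau> \<in> L" if "\<tau> \<subseteq> \<rho>" "\<tau> \<noteq> {}" "\<rho> \<in> L" for \<tau> \<rho>
    by (rule flag_complex_facts(2)[OF L that(3,1,2)])
  {
    fix w assume "w \<in> common_nbrs (parcs (one_skeleton L)) (\<Union>L) \<sigma>"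
    then have w: "w \<in> \<Union>L" "\<And>u. u \<in> \<sigma> \<Longrightarrow> u \<noteq> w \<and> {u, w} \<in> L"
      by (auto simp: common_nbrs_def one_skeleton_def)
    have pairs: "{u, v} \<in> L" if "u \<in> insert w \<sigma>" "v \<in> insert w \<sigma>" "u \<noteq> v" for u v
      using that w(2) sub[of "{u, v}" \<sigma>] \<sigma> by (auto simp: insert_commute)
    have "finite (insert w \<sigma>)" using flag_complex_facts(1)[OF L \<sigma>] by simp
    moreover have "insert w \<sigma> \<subseteq> \<Union>L" using w \<sigma> by auto
    ultimately have "insert w \<sigma> \<in> L" using pairs by (rule flag_complex_facts(3)[OF L _ insert_not_empty])
    then show "w \<in> {w. w \<notin> \<sigma> \<and> insert w \<sigma> \<in> L}" using w by auto
  next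
    fix w assume "w \<in> {w. w \<notin> \<sigma> \<and> insert w \<sigma> \<in> L}"
    then have w: "w \<notin> \<sigma>" "insert w \<sigma> \<in> L" by auto
    have "{u, w} \<in> L" if "u \<in> \<sigma>" for u using that w by (intro sub[OF _ _ w(2)]) auto
    then show "w \<in> common_nbrs (parcs (one_skeleton L)) (\<Union>L) \<sigma>"
      using w by (auto simp: common_nbrs_def one_skeleton_def)
  }
qed

text \<open>Through the translation between simplices and cliques, the ridge count, purity and
  dimension of \<open>L\<close> become the clique hypotheses of
  \<open>reconstruction\<close>.\<close>

lemma homology_manifold_skeleton_reconstructible:
  fixes L :: "'a set set"
  assumes n: "n \<ge> 1" and L: "finite L" "flag_complex L" "homology_manifold n L"
    and graph: "pair_graph (one_skeleton L)" and card: "card (pverts (one_skeleton L)) \<ge> 3"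
  shows "reconstructible TYPE('b) (one_skeleton L)"
  unfolding reconstructible_def
proof (intro allI impI; elim conjE exE)
  fix \<Gamma>' :: "'b pair_pre_digraph" and f
  assume \<Gamma>': "pair_graph \<Gamma>'" and f: "bij_betw f (pverts (one_skeleton L)) (pverts \<Gamma>')"
    and deck: "\<forall>s \<in> pverts (one_skeleton L).
                digraph_iso (with_proj (one_skeleton L) \<restriction> (pverts (one_skeleton L) - {s}))
                            (with_proj \<Gamma>' \<restriction> (pverts \<Gamma>' - {f s}))"
  interpret A: pair_graph "one_skeleton L" by (rule graph)
  interpret B: pair_graph \<Gamma>' by (rule \<Gamma>')
  have V: "pverts (one_skeleton L) = \<Union>L" by (simp add: one_skeleton_def)
  interpret finite_homology_manifold L n
    using L n by unfold_locales (auto simp: flag_complex_def)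
  interpret same_deck "\<Union>L" "parcs (one_skeleton L)" "pverts \<Gamma>'" "parcs \<Gamma>'" f
  proof unfold_locales
    show "finite (\<Union>L)" using A.pair_finite_verts V by simp
    show "irrefl (parcs (one_skeleton L))" by (auto simp: irrefl_def one_skeleton_def)
    show "irrefl (parcs \<Gamma>')" using B.pair_no_loops by (fastforce simp: irrefl_def)
    show "sym (parcs (one_skeleton L))" by (rule symI) (rule A.arcs_symmetric)
    show "sym (parcs \<Gamma>')" by (rule symI) (rule B.arcs_symmetric)
    show "bij_betw f (\<Union>L) (pverts \<Gamma>')" using f V by simp
    show "\<exists>g. rel_iso g (\<Union>L - {s}) (parcs (one_skeleton L)) (pverts \<Gamma>' - {f s}) (parcs \<Gamma>')" if "s \<in> \<Union>L" for s
      by (rule digraph_iso_induced_imp_rel_iso, rule bspec[OF deck[unfolded V] that])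
  qed
  note cl = one_skeleton_cliques[OF L(2)]
  have "\<exists>g. rel_iso g (\<Union>L) (parcs (one_skeleton L)) (pverts \<Gamma>') (parcs \<Gamma>')"
  proof (rule reconstruction[OF _ n])
    show "card (common_nbrs (parcs (one_skeleton L)) (\<Union>L) C) = 2"
      if "C \<in> cliques (parcs (one_skeleton L)) n (\<Union>L)" for C
      using that card_link_ridge unfolding cl[OF n] by (simp add: one_skeleton_common_nbrs[OF L(2)])
    show "\<exists>D\<in>cliques (parcs (one_skeleton L)) (Suc n) (\<Union>L). v \<in> D" if v: "v \<in> \<Union>L" for v
    proof -
      obtain \<sigma> where "\<sigma> \<in> L" "v \<in> \<sigma>" using v by blast
      then show ?thesis using simplex_in_maximal[of \<sigma>] by (auto simp: cl)
    qed
    show "\<exists>D\<in>cliques (parcs (one_skeleton L)) (Suc n) (\<Union>L). u \<in> D \<and> v \<in> D"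
      if "(u, v) \<in> parcs (one_skeleton L)" for u v
    proof -
      have "{u, v} \<in> L" using that by (simp add: one_skeleton_def)
      then show ?thesis using simplex_in_maximal[of "{u, v}"] by (auto simp: cl)
    qed
    show "cliques (parcs (one_skeleton L)) (Suc (Suc n)) (\<Union>L) = {}"
      using card_simplex_le by (fastforce simp: cl)
    show "\<Union>L \<noteq> {}" using card V by force
  qed
  then show "digraph_iso (with_proj \<Gamma>') (with_proj (one_skeleton L))"
    using rel_iso_imp_digraph_iso A.pair_wf_digraph B.pair_wf_digraph V by metis
qed

theorem theorem1p4:
  fixes \<Gamma> :: "'a pair_pre_digraph"
  assumes "pair_graph \<Gamma>"
    and "card (pverts \<Gamma>) \<ge> 3"
  shows "((\<exists>(L :: 'a set set) (n :: nat).
             n \<ge> 1 \<and> finite L \<and> flag_complex L \<and> homology_manifold n L \<and> \<Gamma> = one_skeleton L)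
           \<longrightarrow> reconstructible TYPE('b) \<Gamma>) \<and>
         ((\<exists>(L :: 'a set set) (n :: nat) (M :: 'c topology).
             n \<ge> 1 \<and> topological_manifold n M \<and> flag_triangulation_of L M \<and> \<Gamma> = one_skeleton L)
           \<longrightarrow> reconstructible TYPE('b) \<Gamma>)"
proof (intro conjI impI; elim exE conjE)
  fix L :: "'a set set" and n :: nat
  assume "n \<ge> 1" "finite L" "flag_complex L" "homology_manifold n L" "\<Gamma> = one_skeleton L"
  then show "reconstructible TYPE('b) \<Gamma>"
    using homology_manifold_skeleton_reconstructible[of n L] assms by simp
next
  fix L :: "'a set set" and n :: nat and M :: "'c topology"
  assume n: "n \<ge> 1" and M: "topological_manifold n M" and L: "flag_triangulation_of L M"
    and \<Gamma>: "\<Gamma> = one_skeleton L"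
  \<comment> \<open>Finiteness of the triangulation is not part of its definition; it comes from the
    finite vertex set of \<open>\<Gamma>\<close>.\<close>
  have "finite (\<Union>L)"
    using pair_fin_digraph.pair_finite_verts[of \<Gamma>] assms \<Gamma>
    by (simp add: one_skeleton_def pair_graph_def pair_digraph_def)
  then have "finite L" by (rule finite_UnionD)
  moreover have "homology_manifold n L"
    using homology_manifold_of_topological_manifold[OF M, of L] L by (simp add: flag_triangulation_of_def)
  ultimately show "reconstructible TYPE('b) \<Gamma>"
    using homology_manifold_skeleton_reconstructible[of n L] assms n L \<Gamma>
    by (simp add: flag_triangulation_of_def)
qed

end
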